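(* Let $w\in\tilde H^{1,0}(\mathbb R^{n+1}_+)$ satisfy $\Delta w\ge0$ in the upper half-space in the following weak sense: $$\int_{\mathbb R^{n+1}_+}\nabla\eta\cdot\nabla w\,dz\le0$$ for every non-negative $\eta\in C^1_c(\mathbb R^{n+1}_+)$. Assume additionally that $0\le w\le C(y^d+1)$ for some positive constant $C$ and some $d\in[0,1)$. Then $w$ is identically zero.
   Context: $\mathbb R^{n+1}_+=\{z=(x,y):x\in\mathbb R^n,\ y>0\}$, and $\mathbb R^n$ is identified with $\{y=0\}$. $B_r^+=\{z\in\mathbb R^{n+1}_+:|z|<r\}$. $\tilde H^{1,0}(\mathbb R^{n+1}_+)$ is the set of $u\in W^{1,1}_{\mathrm{loc}}(\mathbb R^{n+1}_+)$ such that for every $r>0$: $\int_{B_r^+}(|\nabla u|^2+u^2)\,dz<\infty$, and there is a sequence $\phi_k\in C^1_c(\overline{B_r^+}\setminus\mathbb R^n)$ with $\int_{B_r^+}(|\nabla(u-\phi_k)|^2+|u-\phi_k|^2)\,dz\to0$. *)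

theory Defs
  imports "HOL-Analysis.Analysis"
begin

definition upper_half :: "((real ^ 'n) \<times> real) set" where
  "upper_half = {z. 0 < snd z}"

definition half_ball :: "real \<Rightarrow> ((real ^ 'n) \<times> real) set" where
  "half_ball r = {z. 0 < snd z \<and> norm z < r}"

text \<open>
  \<open>C1c S \<phi> g\<close> says that \<open>\<phi>\<close> belongs to \<open>C\<^sup>1\<^sub>c(S)\<close> and has (classical) gradient \<open>g\<close> on \<open>S\<close>.
  The set \<open>S\<close> need not be open: differentiability is meant within \<open>S\<close>. If \<open>S\<close> is convex with
  nonempty interior, then \<open>g\<close> is unique on \<open>S\<close>, and the condition means that \<open>\<phi>\<close> is \<open>C\<^sup>1\<close> in the
  interior and continuous on \<open>S\<close>, with a gradient that extends continuously to \<open>S\<close>.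
  Values outside \<open>S\<close> are irrelevant.
\<close>

definition C1c :: "'a::euclidean_space set \<Rightarrow> ('a \<Rightarrow> real) \<Rightarrow> ('a \<Rightarrow> 'a) \<Rightarrow> bool" where
  "C1c S \<phi> g \<longleftrightarrow>
     (\<forall>z\<in>S. (\<phi> has_derivative (\<lambda>h. g z \<bullet> h)) (at z within S)) \<and>
     continuous_on S g \<and>
     compact (closure {z\<in>S. \<phi> z \<noteq> 0}) \<and> closure {z\<in>S. \<phi> z \<noteq> 0} \<subseteq> S"

definition locally_integrable ::
    "'a::euclidean_space set \<Rightarrow> ('a \<Rightarrow> 'b::euclidean_space) \<Rightarrow> bool" where
  "locally_integrable \<Omega> f \<longleftrightarrow> (\<forall>K. compact K \<and> K \<subseteq> \<Omega> \<longrightarrow> f absolutely_integrable_on K)"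

text \<open>
  Weak gradient on an open set \<open>\<Omega>\<close>. The defining identity is vector-valued; its components are
  the usual integrations by parts for the partial derivatives.
\<close>

definition has_weak_gradient ::
    "'a::euclidean_space set \<Rightarrow> ('a \<Rightarrow> real) \<Rightarrow> ('a \<Rightarrow> 'a) \<Rightarrow> bool" where
  "has_weak_gradient \<Omega> u G \<longleftrightarrow>
     locally_integrable \<Omega> G \<and>
     (\<forall>\<phi> g. C1c \<Omega> \<phi> g \<longrightarrow>
        (LINT z:\<Omega>|lebesgue. u z *\<^sub>R g z) = - (LINT z:\<Omega>|lebesgue. \<phi> z *\<^sub>R G z))"

definition W11_loc :: "'a::euclidean_space set \<Rightarrow> ('a \<Rightarrow> real) set" where
  "W11_loc \<Omega> = {u. locally_integrable \<Omega> u \<and> (\<exists>G. has_weak_gradient \<Omega> u G)}"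

text \<open>The choice is immaterial: weak gradients are unique almost everywhere on \<open>\<Omega>\<close>.\<close>

definition weak_grad :: "'a::euclidean_space set \<Rightarrow> ('a \<Rightarrow> real) \<Rightarrow> 'a \<Rightarrow> 'a" where
  "weak_grad \<Omega> u = (SOME G. has_weak_gradient \<Omega> u G)"

text \<open>
  The approximating functions vanish near the flat part \<open>{y = 0}\<close> of the boundary of the half
  ball, but not necessarily on its spherical part. The integrals that tend to \<open>0\<close> are integrals
  of integrable functions, because \<open>u\<close>, its weak gradient, \<open>\<phi> k\<close> and \<open>g k\<close> are all square
  integrable on the half ball.
\<close>

definition H10_tilde :: "((real ^ 'n) \<times> real \<Rightarrow> real) set" where
  "H10_tilde = {u \<in> W11_loc upper_half. \<forall>r>0.
     (\<lambda>z. (norm (weak_grad upper_half u z))\<^sup>2 + (u z)\<^sup>2) absolutely_integrable_on half_ball r \<and>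
     (\<exists>\<phi> g. (\<forall>k::nat. C1c (closure (half_ball r) - {z. snd z = 0}) (\<phi> k) (g k)) \<and>
        (\<lambda>k. LINT z:half_ball r|lebesgue.
           (norm (weak_grad upper_half u z - g k z))\<^sup>2 + \<bar>u z - \<phi> k z\<bar>\<^sup>2) \<longlonglongrightarrow> 0)}"

end

theory Submission
  imports Defs
begin

text \<open>
  Let \<open>N\<close> be the dimension, and put \<open>\<eta> = y f(|z|\<^sup>2)\<close> with \<open>f \<ge> 0\<close> of compact support. Such an \<open>\<eta>\<close> vanishes
  on \<open>y = 0\<close>, so it is a limit of admissible test functions, and since \<open>w\<close> has zero trace, integrating
  by parts once more gives \<open>\<integral> w \<Delta>\<eta> \<ge> 0\<close>. Here \<open>\<Delta>\<eta> = y (4 t f'' + 2 (N + 2) f')\<close> at \<open>t = |z|\<^sup>2\<close>, which is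
  \<open>y\<close> times a radial Laplacian in dimension \<open>N + 2\<close>. Choose \<open>f' = -(1 + t) powr (-(N + 2) / 2)\<close>, cut
  off between \<open>R\<^sup>2\<close> and \<open>2 R\<^sup>2\<close>. Then \<open>\<Delta>\<eta> < 0\<close> for \<open>|z| < R\<close>, and by the growth bound the cutoff region
  contributes \<open>O(R powr (d - 1))\<close>. Letting \<open>R \<rightarrow> \<infinity>\<close>, a positive weight times \<open>w\<close> has integral zero.
\<close>

section \<open>Partial integration for compactly supported functions\<close>

text \<open>Translation invariance of Lebesgue measure makes every difference quotient of
  \<open>F\<close> in direction \<open>b\<close> integrate to zero. The quotients tend to
  \<open>F' z \<bullet> b\<close>, and the Lipschitz bound coming from the bounded gradient permits
  dominated convergence.\<close>

lemma integral_directional_derivative_eq_0: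
  fixes F :: "'a::euclidean_space \<Rightarrow> real"
  assumes der: "\<And>z. (F has_derivative (\<lambda>h. F' z \<bullet> h)) (at z)"
    and cont: "continuous_on UNIV F'"
    and F0: "\<And>z. R < norm z \<Longrightarrow> F z = 0"
    and F'0: "\<And>z. R < norm z \<Longrightarrow> F' z = 0"
  shows "(LINT z|lborel. F' z \<bullet> b) = 0"
proof -
  have "bounded (F' ` cball 0 R)"
    by (intro compact_imp_bounded compact_continuous_image continuous_on_subset[OF cont]) auto
  then obtain M where "M > 0" and M0: "\<And>z. norm z \<le> R \<Longrightarrow> norm (F' z) \<le> M"
    by (auto simp: bounded_pos)
  then have M: "norm (F' z) \<le> M" for z
    using F'0[of z] by (cases "R < norm z") auto
  have contF: "continuous_on UNIV F"
    using der has_derivative_continuous by (blast intro: continuous_at_imp_continuous_on)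
  then have [measurable]: "F \<in> borel_measurable borel"
    by (rule borel_measurable_continuous_onI)
  have [measurable]: "F' \<in> borel_measurable borel"
    using cont by (rule borel_measurable_continuous_onI)
  have lip: "\<bar>F x - F y\<bar> \<le> M * norm (x - y)" for x y
  proof -
    have "norm (F x - F y) \<le> M * norm (x - y)"
    proof (rule differentiable_bound[where S=UNIV])
      show "onorm (\<lambda>h. F' x \<bullet> h) \<le> M" for x
      proof (rule onorm_bound)
        show "norm (F' x \<bullet> h) \<le> M * norm h" for h
          using Cauchy_Schwarz_ineq2[of "F' x" h] mult_right_mono[OF M[of x] norm_ge_zero[of h]]
          by simp
      qed (use \<open>M > 0\<close> in simp)
    qed (use der has_derivative_at_withinI in auto)
    then show ?thesis by simp
  qed
  have intF: "integrable lborel F"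
  proof -
    have "integrable lborel (\<lambda>x. indicator (cball 0 R) x *\<^sub>R F x)"
      by (intro borel_integrable_compact continuous_on_subset[OF contF]) auto
    also have "(\<lambda>x. indicator (cball 0 R) x *\<^sub>R F x) = F"
      using F0 by (auto simp: indicator_def fun_eq_iff not_le)
    finally show ?thesis .
  qed
  define t where "t n = inverse (real (Suc n))" for n
  have t0: "t n > 0" "t n \<le> 1" for n by (auto simp: t_def field_simps)
  define S where "S n z = (F (t n *\<^sub>R b + z) - F z) / t n" for n z
  have shift: "has_bochner_integral lborel (\<lambda>z. F (c + z)) (integral\<^sup>L lborel F)" for c
  proof -
    have "has_bochner_integral (distr lborel borel ((+) c)) F (integral\<^sup>L lborel F)"
      unfolding lborel_distr_plus[of c] using intF by (rule has_bochner_integral_integrable)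
    then show ?thesis by (simp add: has_bochner_integral_iff integrable_distr_eq integral_distr)
  qed
  have S_int: "integral\<^sup>L lborel (S n) = 0" for n
  proof -
    have "has_bochner_integral lborel (\<lambda>z. F (t n *\<^sub>R b + z) - F z)
       (integral\<^sup>L lborel F - integral\<^sup>L lborel F)"
      by (intro has_bochner_integral_diff shift has_bochner_integral_integrable intF)
    then show ?thesis
      unfolding S_def by (simp add: has_bochner_integral_integral_eq)
  qed
  have "(\<lambda>n. integral\<^sup>L lborel (S n)) \<longlonglongrightarrow> (LINT z|lborel. F' z \<bullet> b)"
  proof (rule integral_dominated_convergence)
    \<comment> \<open>The step sizes \<open>t n\<close> are at most 1, so all quotients vanish
      outside the ball of radius \<open>R + norm b\<close>; the majorant is constant on that
      ball.\<close>
    show "integrable lborel (\<lambda>z. indicator (cball 0 (R + norm b)) z *\<^sub>R (M * norm b) :: real)"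
      by (intro borel_integrable_compact) auto
    show "AE z in lborel. norm (S n z) \<le> indicator (cball 0 (R + norm b)) z *\<^sub>R (M * norm b)" for n
    proof (rule AE_I2)
      fix z
      show "norm (S n z) \<le> indicator (cball 0 (R + norm b)) z *\<^sub>R (M * norm b)"
      proof (cases "norm z \<le> R + norm b")
        case True
        have "\<bar>F (t n *\<^sub>R b + z) - F z\<bar> \<le> M * (t n * norm b)"
          using lip[of "t n *\<^sub>R b + z" z] t0[of n] by simp
        then show ?thesis using True t0[of n] by (simp add: S_def field_simps)
      next
        case False
        have "norm (t n *\<^sub>R b) \<le> norm b"
          using t0[of n] by (simp add: mult_left_le_one_le)
        moreover have "norm z \<le> norm (t n *\<^sub>R b + z) + norm (t n *\<^sub>R b)"
          by (metis add_diff_cancel_left' norm_triangle_ineq4)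
        ultimately have "R < norm (t n *\<^sub>R b + z)" "R < norm z"
          using False by (smt (verit) norm_ge_zero)+
        then show ?thesis using False by (simp add: S_def F0)
      qed
    qed
    show "AE z in lborel. (\<lambda>n. S n z) \<longlonglongrightarrow> F' z \<bullet> b"
    proof (rule AE_I2)
      fix z
      have "((\<lambda>s. F (s *\<^sub>R b + z)) has_derivative (\<lambda>s. F' z \<bullet> (s *\<^sub>R b))) (at 0)"
        by (rule has_derivative_compose[where f = "\<lambda>s. s *\<^sub>R b + z" and g = F])
          (use der[of z] in \<open>auto intro!: derivative_eq_intros\<close>)
      then have "((\<lambda>s. F (s *\<^sub>R b + z)) has_real_derivative F' z \<bullet> b) (at 0)"
        unfolding has_field_derivative_def
        by (rule has_derivative_eq_rhs) (simp add: fun_eq_iff mult.commute)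
      then have "((\<lambda>s. (F (s *\<^sub>R b + z) - F z) / s) \<longlongrightarrow> F' z \<bullet> b) (at 0)"
        by (auto simp: has_field_derivative_iff)
      moreover have "filterlim t (at 0) sequentially"
        unfolding filterlim_at using t0(1) LIMSEQ_inverse_real_of_nat
        by (auto simp: t_def[abs_def] intro!: always_eventually)
      ultimately show "(\<lambda>n. S n z) \<longlonglongrightarrow> F' z \<bullet> b"
        unfolding S_def by (rule filterlim_compose)
    qed
  qed (simp_all add: S_def[abs_def])
  then have "(\<lambda>n. 0) \<longlonglongrightarrow> (LINT z|lborel. F' z \<bullet> b)" by (simp add: S_int)
  then show ?thesis using LIMSEQ_unique tendsto_const by blast
qed

lemma gradient_eq_0_open:
  fixes F :: "'a::real_inner \<Rightarrow> real"
  assumes der: "(F has_derivative (\<lambda>h. v \<bullet> h)) (at z)"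
    and U: "open U" "z \<in> U" and F0: "\<And>x. x \<in> U \<Longrightarrow> F x = 0"
  shows "v = 0"
proof -
  have "(F has_derivative (\<lambda>h. 0)) (at z)"
    by (rule has_derivative_transform_within_open[OF _ U, where f = "\<lambda>x. 0"]) (simp_all add: F0)
  then have "(\<lambda>h. v \<bullet> h) = (\<lambda>h. 0)"
    using der has_derivative_unique by blast
  then show ?thesis by (metis inner_eq_zero_iff)
qed

text \<open>\<open>F\<close> is arbitrary outside \<open>A\<close>. Its extension by zero is
  continuously differentiable on the whole space, because \<open>A\<close> and the complement of
  \<open>K\<close> are an open cover and the extension vanishes on the second set; the result on the
  whole space then applies.\<close>

lemma set_integral_directional_derivative_eq_0:
  fixes F :: "'a::euclidean_space \<Rightarrow> real"
  assumes A: "open A" and K: "compact K" "K \<subseteq> A"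
    and der: "\<And>z. z \<in> A \<Longrightarrow> (F has_derivative (\<lambda>h. F' z \<bullet> h)) (at z)"
    and cont: "continuous_on A F'"
    and F0: "\<And>z. z \<in> A - K \<Longrightarrow> F z = 0"
  shows "(LINT z:A|lebesgue. F' z \<bullet> b) = 0"
    and "set_integrable lebesgue A (\<lambda>z. F' z \<bullet> b)"
proof -
  have F'0: "F' z = 0" if "z \<in> A - K" for z
    using that A K by (intro gradient_eq_0_open[OF der, of z "A - K"])
      (auto simp: compact_imp_closed open_Diff F0)
  define E where "E z = (if z \<in> A then F z else 0)" for z
  define E' where "E' z = (if z \<in> A then F' z else 0)" for z
  have oK: "open (- K)" using K by (simp add: compact_imp_closed open_Compl)
  have un: "A \<union> - K = UNIV" using K by auto
  obtain R where R: "\<And>z. z \<in> K \<Longrightarrow> norm z \<le> R"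
    using compact_imp_bounded[OF K(1)] by (auto simp: bounded_iff)
  have "(LINT z|lborel. E' z \<bullet> b) = 0"
  proof (rule integral_directional_derivative_eq_0)
    show "(E has_derivative (\<lambda>h. E' z \<bullet> h)) (at z)" for z
    proof (cases "z \<in> A")
      case True
      have "(E has_derivative (\<lambda>h. F' z \<bullet> h)) (at z)"
        by (rule has_derivative_transform_within_open[OF der[OF True] A True]) (simp add: E_def)
      then show ?thesis using True by (simp add: E'_def)
    next
      case False
      then have "z \<in> - K" using K by auto
      then have "(E has_derivative (\<lambda>h. 0)) (at z)"
        using F0 oK by (rule_tac has_derivative_transform_within_open[where s="-K" and f = "\<lambda>x. 0"])
           (auto simp: E_def)
      then show ?thesis using False by (simp add: E'_def)
    qed
    have "continuous_on A E'" using cont by (simp add: E'_def cong: continuous_on_cong)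
    moreover have "continuous_on (-K) E'"
    proof -
      have "continuous_on (-K) E' \<longleftrightarrow> continuous_on (-K) (\<lambda>z. 0::'a)"
        by (rule continuous_on_cong) (auto simp: E'_def F'0)
      then show ?thesis by simp
    qed
    ultimately show "continuous_on UNIV E'"
      using continuous_on_open_Un[OF A oK] un by metis
    show "E z = 0" "E' z = 0" if "R < norm z" for z
      using that R[of z] F0[of z] F'0[of z] by (auto simp: E_def E'_def)
  qed
  moreover have "E' \<in> borel_measurable borel"
  proof -
    have "E' = (\<lambda>z. indicator A z *\<^sub>R F' z)" by (auto simp: E'_def indicator_def)
    then show ?thesis
      using borel_measurable_continuous_on_indicator[OF _ cont] A by auto
  qed
  ultimately have "(LINT z|lebesgue. E' z \<bullet> b) = 0"
    by (subst integral_completion) auto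
  moreover have EF: "E' z \<bullet> b = indicator A z *\<^sub>R (F' z \<bullet> b)" for z
    by (simp add: E'_def)
  ultimately show "(LINT z:A|lebesgue. F' z \<bullet> b) = 0"
    unfolding set_lebesgue_integral_def by simp
  have "integrable lborel (\<lambda>z. indicator K z *\<^sub>R (F' z \<bullet> b))"
    using K by (intro borel_integrable_compact continuous_intros continuous_on_subset[OF cont])
  then have "integrable lebesgue (\<lambda>z. indicator K z *\<^sub>R (F' z \<bullet> b))"
    by (subst integrable_completion) (auto dest: borel_measurable_integrable)
  then show "set_integrable lebesgue A (\<lambda>z. F' z \<bullet> b)"
    unfolding set_integrable_def
    by (rule Bochner_Integration.integrable_cong[THEN iffD1, rotated -1])
      (use K F'0 in \<open>auto simp: indicator_def\<close>)
qed

text \<open>Local integrability speaks only about compact subsets; an exhaustion of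
  \<open>\<Omega>\<close> by compact sets and a pointwise limit carry measurability over to
  \<open>\<Omega>\<close> itself.\<close>

lemma locally_integrable_measurable:
  fixes f :: "'a::euclidean_space \<Rightarrow> 'b::euclidean_space"
  assumes "open \<Omega>" "locally_integrable \<Omega> f"
  shows "f \<in> borel_measurable (lebesgue_on \<Omega>)"
proof -
  obtain C :: "nat \<Rightarrow> 'a set" where C: "\<And>n. compact (C n)" "\<And>n. C n \<subseteq> \<Omega>"
      "\<And>n. C n \<subseteq> interior (C (Suc n))" "\<Union>(range C) = \<Omega>"
      "\<And>K. \<lbrakk>compact K; K \<subseteq> \<Omega>\<rbrakk> \<Longrightarrow> \<exists>N. \<forall>n\<ge>N. K \<subseteq> C n"
    by (rule open_Union_compact_subsets[OF assms(1)]) metis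
  have "(\<lambda>x. indicator \<Omega> x *\<^sub>R f x) \<in> borel_measurable lebesgue"
  proof (rule borel_measurable_LIMSEQ_metric)
    show "(\<lambda>x. indicator (C n) x *\<^sub>R f x) \<in> borel_measurable lebesgue" for n
      using assms(2) C(1,2)[of n]
      by (auto simp: locally_integrable_def set_integrable_def intro: borel_measurable_integrable)
    show "(\<lambda>n. indicator (C n) x *\<^sub>R f x) \<longlonglongrightarrow> indicator \<Omega> x *\<^sub>R f x" for x
    proof (cases "x \<in> \<Omega>")
      case True
      then obtain N where "\<forall>n\<ge>N. {x} \<subseteq> C n" using C(5)[of "{x}"] by auto
      then have "eventually (\<lambda>n. indicator (C n) x *\<^sub>R f x = indicator \<Omega> x *\<^sub>R f x) sequentially"
        using True by (auto simp: eventually_sequentially intro!: exI[of _ N])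
      then show ?thesis by (rule tendsto_eventually)
    next
      case False
      then have "x \<notin> C n" for n using C(2) by blast
      then show ?thesis using False by simp
    qed
  qed
  then show ?thesis
    using assms(1) by (subst borel_measurable_restrict_space_iff) auto
qed

section \<open>The divergence theorem on half balls\<close>

lemma open_half_ball: "open (half_ball r :: ((real^'n) \<times> real) set)"
proof -
  have "half_ball r = {z::(real^'n) \<times> real. 0 < snd z} \<inter> {z. norm z < r}"
    by (auto simp: half_ball_def)
  also have "open \<dots>"
    by (intro open_Int open_Collect_less continuous_intros)
  finally show ?thesis .
qed

lemma half_ball_subset_ball: "half_ball r \<subseteq> ball 0 r"
  by (auto simp: half_ball_def)

lemma lmeasurable_half_ball: "(half_ball r :: ((real^'n) \<times> real) set) \<in> lmeasurable"
  by (intro lmeasurable_open bounded_subset[OF bounded_ball half_ball_subset_ball] open_half_ball)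

lemma half_ball_subset: "half_ball r \<subseteq> closure (half_ball r) - {z. snd z = 0}"
  using closure_subset by (fastforce simp: half_ball_def)

lemma set_integral_half_ball:
  fixes f :: "(real ^ 'n) \<times> real \<Rightarrow> 'b::euclidean_space"
  shows "(LINT z:half_ball r|lebesgue. f z) = integral\<^sup>L (lebesgue_on (half_ball r)) f"
    and "f absolutely_integrable_on half_ball r \<longleftrightarrow> integrable (lebesgue_on (half_ball r)) f"
  using open_half_ball[of r, where 'n='n]
  by (simp_all add: set_lebesgue_integral_def set_integrable_def integral_restrict_space integrable_restrict_space)

lemma C1c_half_ball_derivative:
  fixes \<phi> :: "(real^'n) \<times> real \<Rightarrow> real"
  assumes "C1c (closure (half_ball r) - {z. snd z = 0}) \<phi> g" and z: "z \<in> half_ball r"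
  shows "(\<phi> has_derivative (\<lambda>h. g z \<bullet> h)) (at z)"
proof -
  have "(\<phi> has_derivative (\<lambda>h. g z \<bullet> h)) (at z within half_ball r)"
  proof (rule has_derivative_subset[OF _ half_ball_subset])
    show "(\<phi> has_derivative (\<lambda>h. g z \<bullet> h)) (at z within closure (half_ball r) - {z. snd z = 0})"
      using assms half_ball_subset unfolding C1c_def by blast
  qed
  then show ?thesis
    using at_within_open[OF z open_half_ball] by simp
qed

text \<open>This makes the approximating functions and their gradients integrable. On the compact
  support the bound follows from continuity; the rest of the half ball is open and
  \<open>\<phi>\<close> vanishes there, so \<open>g\<close> vanishes there too.\<close>

lemma C1c_half_ball_bounded:
  fixes \<phi> :: "(real^'n) \<times> real \<Rightarrow> real"
  assumes C: "C1c (closure (half_ball r) - {z. snd z = 0}) \<phi> g"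
  obtains B where "\<And>z. z \<in> half_ball r \<Longrightarrow> norm (g z) \<le> B" "\<And>z. z \<in> half_ball r \<Longrightarrow> \<bar>\<phi> z\<bar> \<le> B"
proof -
  define S where "S = closure (half_ball r) - {z::(real^'n) \<times> real. snd z = 0}"
  define K where "K = closure {z\<in>S. \<phi> z \<noteq> 0}"
  have K: "compact K" "K \<subseteq> S" and g: "continuous_on S g"
    and der: "\<And>z. z \<in> S \<Longrightarrow> (\<phi> has_derivative (\<lambda>h. g z \<bullet> h)) (at z within S)"
    using C by (auto simp: C1c_def S_def K_def)
  have "continuous_on S \<phi>"
    using der has_derivative_continuous continuous_on_eq_continuous_within by blast
  then have "bounded (\<phi> ` K)" "bounded (g ` K)"
    using K g by (auto intro!: compact_imp_bounded compact_continuous_image intro: continuous_on_subset)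
  then obtain B1 B2 where B: "\<And>z. z \<in> K \<Longrightarrow> \<bar>\<phi> z\<bar> \<le> B1" "\<And>z. z \<in> K \<Longrightarrow> norm (g z) \<le> B2"
    by (auto simp: bounded_iff)
  have zero: "\<phi> z = 0" "g z = 0" if "z \<in> half_ball r" "z \<notin> K" for z
  proof -
    have U: "open (half_ball r - K)" by (intro open_Diff open_half_ball compact_imp_closed K)
    have \<phi>0: "\<phi> x = 0" if "x \<in> half_ball r - K" for x
      using that half_ball_subset[of r] closure_subset[of "{z\<in>S. \<phi> z \<noteq> 0}"] by (auto simp: K_def S_def)
    then show "\<phi> z = 0" using that by simp
    show "g z = 0"
      by (rule gradient_eq_0_open[OF C1c_half_ball_derivative[OF C that(1)] U _ \<phi>0]) (use that in auto)
  qed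
  show ?thesis
  proof
    fix z :: "(real^'n) \<times> real" assume "z \<in> half_ball r"
    then show "norm (g z) \<le> max 0 (max B1 B2)" "\<bar>\<phi> z\<bar> \<le> max 0 (max B1 B2)"
      using B[of z] zero[of z] by (cases "z \<in> K"; force)+
  qed
qed

text \<open>The integrand is the divergence of \<open>\<phi> z *\<^sub>R X z\<close>, where
  \<open>DX b\<close> is the gradient of component \<open>b\<close> of \<open>X\<close>. Near the
  flat part of the boundary \<open>\<phi>\<close> vanishes, near the spherical part \<open>X\<close>
  does, so the product has compact support in the open half ball.\<close>

lemma half_ball_divergence:
  fixes X :: "(real^'n) \<times> real \<Rightarrow> (real^'n) \<times> real"
  assumes C: "C1c (closure (half_ball r) - {z. snd z = 0}) \<phi> g"
    and X: "\<And>b z. b \<in> Basis \<Longrightarrow> ((\<lambda>z. X z \<bullet> b) has_derivative (\<lambda>h. DX b z \<bullet> h)) (at z)"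
    and cX: "\<And>b. b \<in> Basis \<Longrightarrow> continuous_on UNIV (DX b)"
    and s: "s < r" "\<And>z. s \<le> norm z \<Longrightarrow> X z = 0"
  shows "(LINT z:half_ball r|lebesgue. g z \<bullet> X z + \<phi> z * (\<Sum>b\<in>Basis. DX b z \<bullet> b)) = 0"
proof -
  define S where "S = closure (half_ball r) - {z::(real^'n) \<times> real. snd z = 0}"
  define K where "K = closure {z\<in>S. \<phi> z \<noteq> 0} \<inter> cball 0 s"
  have K0: "compact (closure {z\<in>S. \<phi> z \<noteq> 0})" "closure {z\<in>S. \<phi> z \<noteq> 0} \<subseteq> S" and g: "continuous_on S g"
    using C by (auto simp: C1c_def S_def)
  have "closure (half_ball r) \<subseteq> {z::(real^'n) \<times> real. 0 \<le> snd z}"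
    by (rule closure_minimal)
      (auto simp: half_ball_def intro!: closed_Collect_le continuous_intros)
  then have KA: "K \<subseteq> half_ball r"
    using K0(2) s by (fastforce simp: K_def S_def half_ball_def)
  have cK: "compact K" unfolding K_def using K0(1) by (intro compact_Int_closed) auto
  have der\<phi>: "(\<phi> has_derivative (\<lambda>h. g z \<bullet> h)) (at z)" if "z \<in> half_ball r" for z
    using C1c_half_ball_derivative[OF C that] .
  have c\<phi>: "continuous_on (half_ball r) \<phi>"
    using der\<phi> has_derivative_continuous by (blast intro: continuous_at_imp_continuous_on)
  have cg: "continuous_on (half_ball r) g"
    using g half_ball_subset unfolding S_def by (rule continuous_on_subset)
  \<comment> \<open>This is the gradient of \<open>\<phi>\<close> times component \<open>b\<close>
    of \<open>X\<close>; summing its components \<open>b\<close> gives the divergence.\<close>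
  define F' where "F' b z = (X z \<bullet> b) *\<^sub>R g z + \<phi> z *\<^sub>R DX b z" for b z
  have F: "(LINT z:half_ball r|lebesgue. F' b z \<bullet> b) = 0"
       "set_integrable lebesgue (half_ball r) (\<lambda>z. F' b z \<bullet> b)" if b: "b \<in> Basis" for b
  proof -
    have 1: "((\<lambda>z. \<phi> z * (X z \<bullet> b)) has_derivative (\<lambda>h. F' b z \<bullet> h)) (at z)"
      if "z \<in> half_ball r" for z
      by (rule has_derivative_eq_rhs[OF has_derivative_mult[OF der\<phi>[OF that] X[OF b]]])
        (auto simp: F'_def inner_add_left algebra_simps)
    have "continuous_on (half_ball r) (\<lambda>z. X z \<bullet> b)"
      using X[OF b] has_derivative_continuous by (blast intro: continuous_at_imp_continuous_on)
    then have 2: "continuous_on (half_ball r) (F' b)"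
      unfolding F'_def
      by (intro continuous_on_add continuous_on_scaleR c\<phi> cg continuous_on_subset[OF cX[OF b]]) auto
    have 3: "\<phi> z * (X z \<bullet> b) = 0" if "z \<in> half_ball r - K" for z
    proof (cases "z \<in> cball 0 s")
      case True
      then have "z \<notin> closure {z\<in>S. \<phi> z \<noteq> 0}" using that by (simp add: K_def)
      then have "\<phi> z = 0"
        using that half_ball_subset[of r] closure_subset[of "{z\<in>S. \<phi> z \<noteq> 0}"] by (auto simp: S_def)
      then show ?thesis by simp
    qed (use s(2)[of z] in auto)
    show "(LINT z:half_ball r|lebesgue. F' b z \<bullet> b) = 0"
      by (rule set_integral_directional_derivative_eq_0(1)[OF open_half_ball cK KA 1 2 3])
    show "set_integrable lebesgue (half_ball r) (\<lambda>z. F' b z \<bullet> b)"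
      by (rule set_integral_directional_derivative_eq_0(2)[OF open_half_ball cK KA 1 2 3])
  qed
  have "g z \<bullet> X z + \<phi> z * (\<Sum>b\<in>Basis. DX b z \<bullet> b) = (\<Sum>b\<in>Basis. F' b z \<bullet> b)" for z
  proof -
    have "(\<Sum>b\<in>Basis. F' b z \<bullet> b) = (\<Sum>b\<in>Basis. (g z \<bullet> b) * (X z \<bullet> b) + \<phi> z * (DX b z \<bullet> b))"
      by (intro sum.cong refl) (simp add: F'_def inner_add_left mult.commute)
    then show ?thesis
      unfolding sum.distrib sum_distrib_left euclidean_inner[of "g z" "X z"] by simp
  qed
  then have "(LINT z:half_ball r|lebesgue. g z \<bullet> X z + \<phi> z * (\<Sum>b\<in>Basis. DX b z \<bullet> b))
      = (LINT z:half_ball r|lebesgue. (\<Sum>b\<in>Basis. F' b z \<bullet> b))" by simp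
  also have "\<dots> = (\<Sum>b\<in>Basis. LINT z:half_ball r|lebesgue. F' b z \<bullet> b)"
    unfolding set_integral_half_ball(1)
    by (rule Bochner_Integration.integral_sum) (use F(2) in \<open>simp add: set_integral_half_ball(2)\<close>)
  finally show ?thesis using F(1) by simp
qed

section \<open>Measurability and integrability on half balls\<close>

lemma open_upper_half: "open (upper_half :: ((real^'n) \<times> real) set)"
  unfolding upper_half_def by (intro open_Collect_less continuous_intros)

lemma half_ball_subset_upper_half: "half_ball r \<subseteq> upper_half"
  by (auto simp: half_ball_def upper_half_def)

lemma measurable_half_ball:
  fixes f :: "(real ^ 'n) \<times> real \<Rightarrow> 'b::euclidean_space"
  assumes "locally_integrable upper_half f"
  shows "f \<in> borel_measurable (lebesgue_on (half_ball r))"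
  using locally_integrable_measurable[OF open_upper_half assms] half_ball_subset_upper_half
    open_half_ball by (rule_tac measurable_restrict_mono) auto

text \<open>\<open>weak_grad\<close> is a \<open>SOME\<close> choice; membership in
  \<open>W11_loc\<close> supplies the existence that gives it the properties of a weak gradient, in
  particular local integrability.\<close>

lemma H10_tilde_measurable:
  fixes u :: "(real ^ 'n) \<times> real \<Rightarrow> real"
  assumes "u \<in> H10_tilde"
  shows "u \<in> borel_measurable (lebesgue_on (half_ball r))"
    and "weak_grad upper_half u \<in> borel_measurable (lebesgue_on (half_ball r))"
proof -
  have "locally_integrable upper_half u" "\<exists>G. has_weak_gradient upper_half u G"
    using assms by (auto simp: H10_tilde_def W11_loc_def)
  then have "has_weak_gradient upper_half u (weak_grad upper_half u)"
    unfolding weak_grad_def by (metis someI_ex)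
  then show "weak_grad upper_half u \<in> borel_measurable (lebesgue_on (half_ball r))"
    by (intro measurable_half_ball) (simp add: has_weak_gradient_def)
  show "u \<in> borel_measurable (lebesgue_on (half_ball r))"
    by (rule measurable_half_ball) fact
qed

lemma finite_measure_half_ball:
  "finite_measure (lebesgue_on (half_ball r :: ((real^'n) \<times> real) set))"
  by (rule finite_measure_lebesgue_on[OF lmeasurable_half_ball])

lemma measurable_continuous_half_ball:
  fixes f :: "(real ^ 'n) \<times> real \<Rightarrow> 'b::euclidean_space"
  assumes "continuous_on (half_ball r) f"
  shows "f \<in> borel_measurable (lebesgue_on (half_ball r))"
  using assms by (rule continuous_imp_measurable_on_sets_lebesgue) (rule fmeasurableD[OF lmeasurable_half_ball])

lemma integrable_bounded_mult:
  fixes f :: "'a \<Rightarrow> 'b::euclidean_space"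
  assumes "integrable M f" "h \<in> borel_measurable M" "\<And>z. z \<in> space M \<Longrightarrow> norm (h z) \<le> B"
  shows "integrable M (\<lambda>z. f z \<bullet> h z)"
proof (rule Bochner_Integration.integrable_bound)
  show "integrable M (\<lambda>z. B * norm (f z))" using assms(1) by simp
  have [measurable]: "f \<in> borel_measurable M" "h \<in> borel_measurable M" using assms by auto
  show "(\<lambda>z. f z \<bullet> h z) \<in> borel_measurable M" by measurable
  show "AE z in M. norm (f z \<bullet> h z) \<le> norm (B * norm (f z))"
  proof (rule AE_I2)
    fix z assume "z \<in> space M"
    then have "norm (h z) \<le> B" by (rule assms(3))
    then have "norm (f z) * norm (h z) \<le> norm (f z) * B" "0 \<le> B"
      by (simp_all add: mult_left_mono order_trans[OF norm_ge_zero])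
    then show "norm (f z \<bullet> h z) \<le> norm (B * norm (f z))"
      using Cauchy_Schwarz_ineq2[of "f z" "h z"] by (simp add: abs_mult mult.commute)
  qed
qed

text \<open>From \<open>a \<le> 1 + a\<^sup>2\<close> and the finiteness of the measure. The
  majorant \<open>h\<close> allows the sum of squares in \<open>H10_tilde\<close> to serve both for
  \<open>u\<close> and for its gradient.\<close>

lemma integrable_if_square_integrable:
  fixes f :: "'a \<Rightarrow> 'b::euclidean_space"
  assumes "finite_measure M" "f \<in> borel_measurable M" "integrable M h"
    and "\<And>z. z \<in> space M \<Longrightarrow> (norm (f z))\<^sup>2 \<le> h z"
  shows "integrable M f"
proof (rule Bochner_Integration.integrable_bound)
  interpret finite_measure M by fact
  show "integrable M (\<lambda>z. 1 + h z)" using assms(3) by simp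
  show "AE z in M. norm (f z) \<le> norm (1 + h z)"
  proof (rule AE_I2)
    fix z assume z: "z \<in> space M"
    have "norm (f z) \<le> 1 + (norm (f z))\<^sup>2"
      using sum_power2_ge_zero[of "norm (f z) - 1" 0] by (simp add: power2_diff) (smt (verit) norm_ge_zero)
    then show "norm (f z) \<le> norm (1 + h z)"
      using assms(4)[OF z] zero_le_power2[of "norm (f z)"] by simp
  qed
qed fact

text \<open>The vanishing trace of \<open>u\<close> on \<open>y = 0\<close> enters here: it is what removes the boundary term,
  although \<open>X\<close> need not vanish on \<open>y = 0\<close>.\<close>

lemma H10_tilde_divergence:
  fixes X :: "(real^'n) \<times> real \<Rightarrow> (real^'n) \<times> real"
  assumes u: "u \<in> H10_tilde" and r: "0 < r"
    and X: "\<And>b z. b \<in> Basis \<Longrightarrow> ((\<lambda>z. X z \<bullet> b) has_derivative (\<lambda>h. DX b z \<bullet> h)) (at z)"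
    and cX: "\<And>b. b \<in> Basis \<Longrightarrow> continuous_on UNIV (DX b)"
    and s: "s < r" "\<And>z. s \<le> norm z \<Longrightarrow> X z = 0"
  defines "D \<equiv> \<lambda>z. \<Sum>b\<in>Basis. DX b z \<bullet> b"
  defines "M \<equiv> lebesgue_on (half_ball r)"
  shows "integrable M (\<lambda>z. weak_grad upper_half u z \<bullet> X z)"
    and "integrable M (\<lambda>z. u z * D z)"
    and "(LINT z|M. weak_grad upper_half u z \<bullet> X z) = - (LINT z|M. u z * D z)"
proof -
  interpret finite_measure M unfolding M_def by (rule finite_measure_half_ball)
  have sp: "space M = half_ball r" by (simp add: M_def)
  define G where "G = weak_grad upper_half u"
  note [measurable] = H10_tilde_measurable[OF u, of r, folded M_def, folded G_def]
  have cX': "continuous_on UNIV X"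
  proof (subst continuous_on_componentwise, intro ballI)
    fix b :: "(real^'n) \<times> real" assume "b \<in> Basis"
    then show "continuous_on UNIV (\<lambda>z. X z \<bullet> b)"
      using X has_derivative_continuous by (blast intro: continuous_at_imp_continuous_on)
  qed
  have cD: "continuous_on UNIV D"
    unfolding D_def by (intro continuous_intros cX)
  have [measurable]: "X \<in> borel_measurable M" "D \<in> borel_measurable M"
    unfolding M_def
    by (intro measurable_continuous_half_ball continuous_on_subset[OF cX'] continuous_on_subset[OF cD] subset_UNIV)+
  have "bounded (X ` cball 0 r)" "bounded (D ` cball 0 r)"
    by (intro compact_imp_bounded compact_continuous_image continuous_on_subset[OF cX']
        continuous_on_subset[OF cD]; simp)+
  then obtain B1 B2 where "\<forall>z\<in>cball 0 r. norm (X z) \<le> B1" "\<forall>z\<in>cball 0 r. \<bar>D z\<bar> \<le> B2"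
    unfolding bounded_iff by auto
  then have B12: "norm (X z) \<le> B1" "\<bar>D z\<bar> \<le> B2" if "z \<in> half_ball r" for z
    using that half_ball_subset_ball[of r] ball_subset_cball[of 0 r] by blast+
  define B where "B = max 1 (max B1 B2)"
  have B: "norm (X z) \<le> B" "\<bar>D z\<bar> \<le> B" if "z \<in> half_ball r" for z
    using B12[OF that] by (auto simp: B_def)
  have sq: "integrable M (\<lambda>z. (norm (G z))\<^sup>2 + (u z)\<^sup>2)"
    using u r by (auto simp: H10_tilde_def set_integral_half_ball G_def M_def)
  have iG: "integrable M G"
    by (rule integrable_if_square_integrable[OF finite_measure_axioms _ sq]) simp_all
  have iu: "integrable M u"
    by (rule integrable_if_square_integrable[OF finite_measure_axioms _ sq]) simp_all
  show 1: "integrable M (\<lambda>z. weak_grad upper_half u z \<bullet> X z)"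
    unfolding G_def[symmetric] by (rule integrable_bounded_mult[OF iG, of _ B]) (auto simp: sp B)
  show 2: "integrable M (\<lambda>z. u z * D z)"
    using integrable_bounded_mult[OF iu, of D B] by (auto simp: sp B)
  \<comment> \<open>The defect in the integration by parts for \<open>u\<close>, to be shown
    zero.\<close>
  define L where "L = (LINT z|M. G z \<bullet> X z + u z * D z)"
  obtain \<phi> g where C: "\<And>k::nat. C1c (closure (half_ball r) - {z. snd z = 0}) (\<phi> k) (g k)"
    and lim: "(\<lambda>k. LINT z:half_ball r|lebesgue. (norm (G z - g k z))\<^sup>2 + \<bar>u z - \<phi> k z\<bar>\<^sup>2) \<longlonglongrightarrow> 0"
    using u r unfolding H10_tilde_def G_def by blast
  define I where "I k = (LINT z|M. (norm (G z - g k z))\<^sup>2 + \<bar>u z - \<phi> k z\<bar>\<^sup>2)" for k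
  have lim: "I \<longlonglongrightarrow> 0" using lim unfolding I_def M_def by (simp add: set_integral_half_ball)
  \<comment> \<open>The approximating functions have no defect, so \<open>L\<close> is the integral
    of the differences. Young's inequality
    \<open>a \<le> \<delta> / 2 + a\<^sup>2 / (2 * \<delta>)\<close> turns these into the squares
    that \<open>I k\<close> controls; it takes the place of the Cauchy-Schwarz inequality for
    integrals.\<close>
  have bound: "\<bar>L\<bar> \<le> B * (\<delta> * measure M (space M) + I k / (2 * \<delta>))" if \<delta>: "\<delta> > 0" for \<delta> k
  proof -
    have d: "(\<phi> k has_derivative (\<lambda>h. g k z \<bullet> h)) (at z)" if "z \<in> half_ball r" for z
      by (rule C1c_half_ball_derivative[OF C that])
    have "continuous_on (half_ball r) (\<phi> k)"
      using d has_derivative_continuous by (blast intro: continuous_at_imp_continuous_on)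
    then have [measurable]: "\<phi> k \<in> borel_measurable M"
      unfolding M_def by (rule measurable_continuous_half_ball)
    have "continuous_on (half_ball r) (g k)"
      using C[of k] half_ball_subset unfolding C1c_def by (blast intro: continuous_on_subset)
    then have [measurable]: "g k \<in> borel_measurable M"
      unfolding M_def by (rule measurable_continuous_half_ball)
    obtain E where E: "\<And>z. z \<in> half_ball r \<Longrightarrow> norm (g k z) \<le> E" "\<And>z. z \<in> half_ball r \<Longrightarrow> \<bar>\<phi> k z\<bar> \<le> E"
      using C1c_half_ball_bounded[OF C[of k]] by blast
    have ig: "integrable M (g k)" "integrable M (\<phi> k)"
      by (rule integrable_const_bound[where B=E]; use E sp in auto)+
    have igX: "integrable M (\<lambda>z. g k z \<bullet> X z)"
      by (rule integrable_bounded_mult[OF ig(1), of _ B]) (auto simp: sp B)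
    have i\<phi>D: "integrable M (\<lambda>z. \<phi> k z * D z)"
      using integrable_bounded_mult[OF ig(2), of D B] by (auto simp: sp B)
    \<comment> \<open>The integral of a non-integrable function is 0 by default, so without this the
      convergence of \<open>I\<close> would carry no information.\<close>
    have sqk: "integrable M (\<lambda>z. (norm (G z - g k z))\<^sup>2 + \<bar>u z - \<phi> k z\<bar>\<^sup>2)"
    proof (rule Bochner_Integration.integrable_bound)
      show "integrable M (\<lambda>z. 2 * ((norm (G z))\<^sup>2 + (u z)\<^sup>2) + 4 * E\<^sup>2)"
        by (intro Bochner_Integration.integrable_add integrable_mult_right integrable_const sq)
      show "AE z in M. norm ((norm (G z - g k z))\<^sup>2 + \<bar>u z - \<phi> k z\<bar>\<^sup>2)
          \<le> norm (2 * ((norm (G z))\<^sup>2 + (u z)\<^sup>2) + 4 * E\<^sup>2)"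
      proof (rule AE_I2)
        fix z assume "z \<in> space M"
        then have z: "z \<in> half_ball r" by (simp add: sp)
        have young: "(a + b)\<^sup>2 \<le> 2 * a\<^sup>2 + 2 * E\<^sup>2" if "0 \<le> b" "b \<le> E" for a b :: real
          using sum_squares_bound[of a b] power_mono[OF that(2,1), of 2] by (simp add: power2_sum)
        have "(norm (G z - g k z))\<^sup>2 \<le> (norm (G z) + norm (g k z))\<^sup>2"
          by (intro power_mono norm_triangle_ineq4) simp
        also have "\<dots> \<le> 2 * (norm (G z))\<^sup>2 + 2 * E\<^sup>2" by (rule young) (use E(1)[OF z] in auto)
        finally have a: "(norm (G z - g k z))\<^sup>2 \<le> 2 * (norm (G z))\<^sup>2 + 2 * E\<^sup>2" .
        have "\<bar>u z - \<phi> k z\<bar>\<^sup>2 \<le> (\<bar>u z\<bar> + \<bar>\<phi> k z\<bar>)\<^sup>2" by (intro power_mono) auto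
        also have "\<dots> \<le> 2 * \<bar>u z\<bar>\<^sup>2 + 2 * E\<^sup>2" by (rule young) (use E(2)[OF z] in auto)
        finally show "norm ((norm (G z - g k z))\<^sup>2 + \<bar>u z - \<phi> k z\<bar>\<^sup>2)
          \<le> norm (2 * ((norm (G z))\<^sup>2 + (u z)\<^sup>2) + 4 * E\<^sup>2)" using a by simp
      qed
    qed simp
    have "(LINT z|M. g k z \<bullet> X z + \<phi> k z * D z) = 0"
      using half_ball_divergence[OF C X cX s] unfolding set_integral_half_ball M_def D_def by blast
    then have "L = L - (LINT z|M. g k z \<bullet> X z + \<phi> k z * D z)" by simp
    also have "\<dots> = (LINT z|M. (G z \<bullet> X z + u z * D z) - (g k z \<bullet> X z + \<phi> k z * D z))"
      unfolding L_def using 1 2 igX i\<phi>D unfolding G_def[symmetric]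
      by (intro Bochner_Integration.integral_diff[symmetric] Bochner_Integration.integrable_add)
    also have "\<bar>\<dots>\<bar> \<le> (LINT z|M. B * (\<delta> + ((norm (G z - g k z))\<^sup>2 + \<bar>u z - \<phi> k z\<bar>\<^sup>2) / (2 * \<delta>)))"
    proof (rule order_trans[OF integral_abs_bound], rule integral_mono)
      show "integrable M (\<lambda>z. \<bar>(G z \<bullet> X z + u z * D z) - (g k z \<bullet> X z + \<phi> k z * D z)\<bar>)"
        using 1 2 igX i\<phi>D unfolding G_def[symmetric] by simp
      show "integrable M (\<lambda>z. B * (\<delta> + ((norm (G z - g k z))\<^sup>2 + \<bar>u z - \<phi> k z\<bar>\<^sup>2) / (2 * \<delta>)))"
        by (intro Bochner_Integration.integrable_add integrable_mult_right integrable_divide_zero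
            integrable_const sqk)
      fix z assume "z \<in> space M"
      then have z: "z \<in> half_ball r" by (simp add: sp)
      have am: "a \<le> \<delta> / 2 + a\<^sup>2 / (2 * \<delta>)" for a
        using sum_squares_bound[of a \<delta>] \<delta> by (simp add: field_simps power2_eq_square)
      have "\<bar>(G z \<bullet> X z + u z * D z) - (g k z \<bullet> X z + \<phi> k z * D z)\<bar>
          = \<bar>(G z - g k z) \<bullet> X z + (u z - \<phi> k z) * D z\<bar>"
        by (simp add: inner_diff_left algebra_simps)
      also have "\<dots> \<le> norm (G z - g k z) * norm (X z) + \<bar>u z - \<phi> k z\<bar> * \<bar>D z\<bar>"
        using Cauchy_Schwarz_ineq2[of "G z - g k z" "X z"] abs_mult[of "u z - \<phi> k z" "D z"]
          abs_triangle_ineq[of "(G z - g k z) \<bullet> X z" "(u z - \<phi> k z) * D z"] by linarith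
      also have "\<dots> \<le> norm (G z - g k z) * B + \<bar>u z - \<phi> k z\<bar> * B"
        using B[OF z] by (intro add_mono mult_left_mono) auto
      also have "\<dots> = B * (norm (G z - g k z) + \<bar>u z - \<phi> k z\<bar>)" by (simp add: algebra_simps)
      also have "\<dots> \<le> B * ((\<delta> / 2 + (norm (G z - g k z))\<^sup>2 / (2 * \<delta>)) + (\<delta> / 2 + \<bar>u z - \<phi> k z\<bar>\<^sup>2 / (2 * \<delta>)))"
        by (intro mult_left_mono add_mono am) (simp add: B_def)
      also have "\<dots> = B * (\<delta> + ((norm (G z - g k z))\<^sup>2 + \<bar>u z - \<phi> k z\<bar>\<^sup>2) / (2 * \<delta>))"
        by (simp add: add_divide_distrib)
      finally show "\<bar>(G z \<bullet> X z + u z * D z) - (g k z \<bullet> X z + \<phi> k z * D z)\<bar>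
         \<le> B * (\<delta> + ((norm (G z - g k z))\<^sup>2 + \<bar>u z - \<phi> k z\<bar>\<^sup>2) / (2 * \<delta>))" .
    qed
    also have "\<dots> = B * (\<delta> * measure M (space M) + I k / (2 * \<delta>))"
      using sqk by (simp add: I_def)
    finally show ?thesis .
  qed
  \<comment> \<open>The order of limits matters, since \<open>I k\<close> is divided by
    \<open>\<delta>\<close>: first \<open>k\<close> tends to infinity for fixed
    \<open>\<delta>\<close>, then \<open>\<delta>\<close> tends to 0.\<close>
  have bound': "\<bar>L\<bar> \<le> B * (\<delta> * measure M (space M))" if "\<delta> > 0" for \<delta>
  proof (rule LIMSEQ_le_const)
    show "(\<lambda>k. B * (\<delta> * measure M (space M) + I k / (2 * \<delta>))) \<longlonglongrightarrow> B * (\<delta> * measure M (space M))"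
      using that by (auto intro!: tendsto_eq_intros lim)
  qed (use bound[OF that] in blast)
  have "\<bar>L\<bar> \<le> 0"
  proof (rule LIMSEQ_le_const)
    show "(\<lambda>n. B * (inverse (real (Suc n)) * measure M (space M))) \<longlonglongrightarrow> 0"
      using tendsto_mult[OF tendsto_const[of B] tendsto_mult[OF LIMSEQ_inverse_real_of_nat
          tendsto_const[of "measure M (space M)"]]] by simp
  qed (use bound' in \<open>auto simp del: of_nat_Suc\<close>)
  then have "L = 0" by simp
  then show "(LINT z|M. weak_grad upper_half u z \<bullet> X z) = - (LINT z|M. u z * D z)"
    using 1 2 unfolding L_def G_def by simp
qed

section \<open>Radial test functions\<close>

text \<open>Replacing \<open>y\<close> by the truncation \<open>(y - \<epsilon>)\<^sub>+\<^sup>2 / y\<close> makes \<open>y f (z \<bullet> z)\<close> vanish near \<open>y = 0\<close>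
  while keeping its gradient bounded uniformly in \<open>\<epsilon>\<close>.\<close>

definition trunc :: "real \<Rightarrow> real \<Rightarrow> real" where
  "trunc \<epsilon> y = (max 0 (y - \<epsilon>))\<^sup>2 / y"

definition trunc_deriv :: "real \<Rightarrow> real \<Rightarrow> real" where
  "trunc_deriv \<epsilon> y = max 0 (y - \<epsilon>) * (y + \<epsilon>) / y\<^sup>2"

text \<open>The critical point is 0, where the difference quotient is at most
  \<open>\<bar>h\<bar>\<close>. Squared positive parts are the building block of both the truncation
  and the cutoff, which have to be continuously differentiable.\<close>

lemma has_real_derivative_pos_part_square:
  "((\<lambda>x. (max 0 x)\<^sup>2) has_real_derivative 2 * max 0 x) (at x)" for x :: real
proof (cases x "0::real" rule: linorder_cases)
  case less
  have "((\<lambda>x. 0) has_real_derivative 2 * max 0 x) (at x)" using less by simp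
  then show ?thesis
    by (rule DERIV_cong_ev[THEN iffD1, rotated -1])
      (use less eventually_nhds_in_open[of "{..<0}" x] in \<open>auto elim!: eventually_mono\<close>)
next
  case equal
  have "((\<lambda>h. (max 0 h)\<^sup>2 / h) \<longlongrightarrow> 0) (at (0::real))"
  proof (rule Lim_null_comparison)
    show "eventually (\<lambda>h. norm ((max 0 h)\<^sup>2 / h) \<le> \<bar>h\<bar>) (at (0::real))"
      by (auto intro!: always_eventually simp: max_def power2_eq_square)
    show "((\<lambda>h. \<bar>h\<bar>) \<longlongrightarrow> 0) (at (0::real))" by (auto intro!: tendsto_eq_intros)
  qed
  then show ?thesis using equal by (simp add: has_field_derivative_iff)
next
  case greater
  have "((\<lambda>x. x\<^sup>2) has_real_derivative 2 * max 0 x) (at x)"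
    using greater by (auto intro!: derivative_eq_intros)
  then show ?thesis
    by (rule DERIV_cong_ev[THEN iffD1, rotated -1])
      (use greater eventually_nhds_in_open[of "{0<..}" x] in \<open>auto elim!: eventually_mono\<close>)
qed

lemma trunc_has_derivative:
  assumes "0 < y"
  shows "(trunc \<epsilon> has_real_derivative trunc_deriv \<epsilon> y) (at y)"
proof -
  have "((\<lambda>y. (max 0 (y - \<epsilon>))\<^sup>2) has_real_derivative 2 * max 0 (y - \<epsilon>)) (at y)"
    using DERIV_chain2[OF has_real_derivative_pos_part_square[of "y - \<epsilon>"]
        DERIV_diff[OF DERIV_ident DERIV_const[of \<epsilon>]]] by simp
  then have "((\<lambda>y. (max 0 (y - \<epsilon>))\<^sup>2 / y) has_real_derivative
      (2 * max 0 (y - \<epsilon>) * y - (max 0 (y - \<epsilon>))\<^sup>2 * 1) / (y * y)) (at y)"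
    using assms by (intro DERIV_divide DERIV_ident) auto
  moreover have "(2 * max 0 (y - \<epsilon>) * y - (max 0 (y - \<epsilon>))\<^sup>2 * 1) / (y * y) = trunc_deriv \<epsilon> y"
    by (cases "y \<le> \<epsilon>") (auto simp: trunc_deriv_def max_def power2_eq_square algebra_simps)
  ultimately show ?thesis by (simp add: trunc_def[abs_def])
qed

text \<open>For \<open>\<epsilon> \<le> y\<close> the derivative is
  \<open>1 - \<epsilon>\<^sup>2 / y\<^sup>2\<close>. The upper bounds do not involve
  \<open>\<epsilon>\<close>, which later provides a majorant as \<open>\<epsilon>\<close> tends to
  0.\<close>

lemma trunc_bounds:
  assumes "0 < \<epsilon>" "0 < y"
  shows "0 \<le> trunc \<epsilon> y" "trunc \<epsilon> y \<le> y" "0 \<le> trunc_deriv \<epsilon> y" "trunc_deriv \<epsilon> y \<le> 1"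
    "y \<le> \<epsilon> \<Longrightarrow> trunc \<epsilon> y = 0"
proof -
  have m: "0 \<le> max 0 (y - \<epsilon>)" "max 0 (y - \<epsilon>) \<le> y" using assms by auto
  show "0 \<le> trunc \<epsilon> y" "0 \<le> trunc_deriv \<epsilon> y" "y \<le> \<epsilon> \<Longrightarrow> trunc \<epsilon> y = 0"
    using assms by (auto simp: trunc_def trunc_deriv_def)
  show "trunc \<epsilon> y \<le> y"
    using power_mono[OF m(2,1), of 2] assms by (simp add: trunc_def divide_simps power2_eq_square)
  have "max 0 (y - \<epsilon>) * (y + \<epsilon>) \<le> y\<^sup>2"
    by (cases "y \<le> \<epsilon>") (auto simp: max_def power2_eq_square algebra_simps)
  then show "trunc_deriv \<epsilon> y \<le> 1" using assms by (simp add: trunc_deriv_def)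
qed

lemma trunc_tendsto:
  assumes "0 < y" "\<epsilon> \<longlonglongrightarrow> 0"
  shows "(\<lambda>n. trunc (\<epsilon> n) y) \<longlonglongrightarrow> y" "(\<lambda>n. trunc_deriv (\<epsilon> n) y) \<longlonglongrightarrow> 1"
proof -
  have "(\<lambda>n. trunc (\<epsilon> n) y) \<longlonglongrightarrow> (max 0 (y - 0))\<^sup>2 / y"
    unfolding trunc_def using assms by (intro tendsto_intros) auto
  then show "(\<lambda>n. trunc (\<epsilon> n) y) \<longlonglongrightarrow> y" using assms by (simp add: power2_eq_square)
  have "(\<lambda>n. trunc_deriv (\<epsilon> n) y) \<longlonglongrightarrow> max 0 (y - 0) * (y + 0) / y\<^sup>2"
    unfolding trunc_deriv_def using assms by (intro tendsto_intros) auto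
  then show "(\<lambda>n. trunc_deriv (\<epsilon> n) y) \<longlonglongrightarrow> 1" using assms by (simp add: power2_eq_square)
qed

text \<open>The variable \<open>t\<close> stands for \<open>z \<bullet> z\<close>, which unlike
  \<open>norm z\<close> is smooth at the origin; accordingly the threshold is
  \<open>s\<^sup>2\<close>. Derivatives at \<open>t = 0\<close> are two-sided, so that the chain
  rule applies at the origin as well.\<close>

locale radial_profile =
  fixes f f' f'' :: "real \<Rightarrow> real" and s :: real
  assumes f: "\<And>t. 0 \<le> t \<Longrightarrow> (f has_real_derivative f' t) (at t)"
    and f': "\<And>t. 0 \<le> t \<Longrightarrow> (f' has_real_derivative f'' t) (at t)"
    and f'': "continuous_on {0..} f''"
    and s: "0 \<le> s"
    and f_0: "\<And>t. s\<^sup>2 \<le> t \<Longrightarrow> f t = 0" "\<And>t. s\<^sup>2 \<le> t \<Longrightarrow> f' t = 0"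
    and f_nonneg: "\<And>t. 0 \<le> t \<Longrightarrow> 0 \<le> f t"
begin

lemma continuous_f: "continuous_on {0..} f"
  by (intro continuous_at_imp_continuous_on ballI DERIV_isCont[OF f]) simp

lemma continuous_f': "continuous_on {0..} f'"
  by (intro continuous_at_imp_continuous_on ballI DERIV_isCont[OF f']) simp

lemma derivative_radial:
  fixes z :: "'a::euclidean_space"
  shows "((\<lambda>z. f (z \<bullet> z)) has_derivative (\<lambda>h. (2 * (z \<bullet> h)) * f' (z \<bullet> z))) (at z)"
    and "((\<lambda>z. f' (z \<bullet> z)) has_derivative (\<lambda>h. (2 * (z \<bullet> h)) * f'' (z \<bullet> z))) (at z)"
proof -
  have "((\<lambda>z::'a. z \<bullet> z) has_derivative (\<lambda>h. 2 * (z \<bullet> h))) (at z)"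
    by (auto intro!: derivative_eq_intros simp: inner_commute)
  from DERIV_compose_FDERIV[OF f[of "z \<bullet> z"] this] DERIV_compose_FDERIV[OF f'[of "z \<bullet> z"] this]
  show "((\<lambda>z. f (z \<bullet> z)) has_derivative (\<lambda>h. (2 * (z \<bullet> h)) * f' (z \<bullet> z))) (at z)"
     "((\<lambda>z. f' (z \<bullet> z)) has_derivative (\<lambda>h. (2 * (z \<bullet> h)) * f'' (z \<bullet> z))) (at z)"
    by simp_all
qed

text \<open>The gradient of \<open>(z \<bullet> e) * f (z \<bullet> z)\<close>, and the gradient of its component \<open>b\<close>.\<close>

definition field :: "'a::euclidean_space \<Rightarrow> 'a \<Rightarrow> 'a" where
  "field e z = f (z \<bullet> z) *\<^sub>R e + (2 * (z \<bullet> e) * f' (z \<bullet> z)) *\<^sub>R z"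

definition field_deriv :: "'a::euclidean_space \<Rightarrow> 'a \<Rightarrow> 'a \<Rightarrow> 'a" where
  "field_deriv e b z = (2 * f' (z \<bullet> z) * (e \<bullet> b)) *\<^sub>R z + (2 * f' (z \<bullet> z) * (z \<bullet> b)) *\<^sub>R e
     + (4 * (z \<bullet> e) * f'' (z \<bullet> z) * (z \<bullet> b)) *\<^sub>R z + (2 * (z \<bullet> e) * f' (z \<bullet> z)) *\<^sub>R b"

lemma field_has_derivative:
  "((\<lambda>z. field e z \<bullet> b) has_derivative (\<lambda>h. field_deriv e b z \<bullet> h)) (at z)"
proof -
  have "((\<lambda>z. f (z \<bullet> z) * (e \<bullet> b) + (2 * (z \<bullet> e) * f' (z \<bullet> z)) * (z \<bullet> b)) has_derivative
     (\<lambda>h. field_deriv e b z \<bullet> h)) (at z)"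
    by (rule derivative_eq_intros derivative_radial refl)+
      (auto simp: fun_eq_iff field_deriv_def inner_add_left inner_commute algebra_simps)
  then show ?thesis by (simp add: field_def inner_add_left)
qed

lemma continuous_radial:
  "continuous_on S (\<lambda>z::'a::euclidean_space. f (z \<bullet> z))"
  "continuous_on S (\<lambda>z::'a. f' (z \<bullet> z))"
  "continuous_on S (\<lambda>z::'a. f'' (z \<bullet> z))"
  by (rule continuous_on_compose2[OF continuous_f] continuous_on_compose2[OF continuous_f']
        continuous_on_compose2[OF f'']; auto intro!: continuous_intros)+

lemma continuous_field: "continuous_on S (field e)"
  unfolding field_def by (intro continuous_intros continuous_radial)

lemma continuous_field_deriv: "continuous_on UNIV (field_deriv e b)"
  unfolding field_deriv_def by (intro continuous_intros continuous_radial)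

text \<open>This is the Laplacian of \<open>(z \<bullet> e) * f (z \<bullet> z)\<close> in dimension
  \<open>N = DIM('a)\<close>. The radial factor contributes \<open>4 * t * f'' + 2 * N * f'\<close>,
  and the cross term of the product rule adds \<open>4 * f'\<close>, which shifts the dimension to
  \<open>N + 2\<close>.\<close>

lemma divergence_field:
  fixes z :: "'a::euclidean_space"
  assumes "e \<in> Basis"
  shows "(\<Sum>b\<in>Basis. field_deriv e b z \<bullet> b)
    = (z \<bullet> e) * (4 * (z \<bullet> z) * f'' (z \<bullet> z) + 2 * (real DIM('a) + 2) * f' (z \<bullet> z))"
proof -
  have "(\<Sum>b\<in>Basis. field_deriv e b z \<bullet> b) = (\<Sum>b\<in>Basis. (4 * f' (z \<bullet> z)) * ((z \<bullet> b) * (e \<bullet> b))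
     + (4 * (z \<bullet> e) * f'' (z \<bullet> z)) * ((z \<bullet> b) * (z \<bullet> b)) + 2 * (z \<bullet> e) * f' (z \<bullet> z))"
    by (intro sum.cong refl) (simp add: field_deriv_def inner_add_left algebra_simps)
  also have "\<dots> = 4 * f' (z \<bullet> z) * (z \<bullet> e) + (4 * (z \<bullet> e) * f'' (z \<bullet> z)) * (z \<bullet> z)
     + real DIM('a) * (2 * (z \<bullet> e) * f' (z \<bullet> z))"
    unfolding sum.distrib sum_distrib_left[symmetric] euclidean_inner[of z e, symmetric]
      euclidean_inner[of z z, symmetric] by simp
  finally show ?thesis by (simp add: algebra_simps)
qed

lemma field_eq_0: "s \<le> norm z \<Longrightarrow> field e z = 0"
  using f_0[of "z \<bullet> z"] s power_mono[of s "norm z" 2] by (simp add: field_def dot_square_norm)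

section \<open>Truncated test functions with compact support in the open half-space\<close>

definition test :: "real \<Rightarrow> (real^'n) \<times> real \<Rightarrow> real" where
  "test \<epsilon> z = trunc \<epsilon> (snd z) * f (z \<bullet> z)"

definition test_grad :: "real \<Rightarrow> (real^'n) \<times> real \<Rightarrow> (real^'n) \<times> real" where
  "test_grad \<epsilon> z = (trunc_deriv \<epsilon> (snd z) * f (z \<bullet> z)) *\<^sub>R (0, 1)
     + (2 * trunc \<epsilon> (snd z) * f' (z \<bullet> z)) *\<^sub>R z"

lemma test_grad_eq_0: "s \<le> norm z \<Longrightarrow> test_grad \<epsilon> z = 0"
  using f_0[of "z \<bullet> z"] s power_mono[of s "norm z" 2] by (simp add: test_grad_def dot_square_norm zero_prod_def)

text \<open>The support lies in the set where \<open>\<epsilon> \<le> snd z\<close> and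
  \<open>norm z \<le> s\<close>, which is compact and stays away from the boundary. Hence the weak
  inequality may be tested with \<open>test \<epsilon>\<close>.\<close>

lemma C1c_test:
  assumes \<epsilon>: "0 < \<epsilon>"
  shows "C1c upper_half (test \<epsilon> :: (real^'n) \<times> real \<Rightarrow> real) (test_grad \<epsilon>)"
    (is "C1c ?U ?\<eta> ?g")
proof -
  have der: "(?\<eta> has_derivative (\<lambda>h. ?g z \<bullet> h)) (at z within ?U)" if "z \<in> ?U" for z
  proof -
    have y: "0 < snd z" using that by (simp add: upper_half_def)
    have "((\<lambda>z. trunc \<epsilon> (snd z)) has_derivative (\<lambda>h. snd h * trunc_deriv \<epsilon> (snd z))) (at z within ?U)"
      by (intro DERIV_compose_FDERIV trunc_has_derivative y) (auto intro!: derivative_eq_intros)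
    from has_derivative_mult[OF this has_derivative_at_withinI[OF derivative_radial(1)]]
    show ?thesis unfolding test_def
      by (rule has_derivative_eq_rhs)
        (auto simp: fun_eq_iff test_grad_def inner_add_left inner_Pair_0 inner_prod_def algebra_simps)
  qed
  have cg: "continuous_on ?U ?g"
  proof -
    have 1: "continuous_on ?U (\<lambda>z. trunc_deriv \<epsilon> (snd z))"
      unfolding trunc_deriv_def by (intro continuous_intros) (auto simp: upper_half_def)
    have 2: "continuous_on ?U (\<lambda>z. trunc \<epsilon> (snd z))"
      unfolding trunc_def by (intro continuous_intros) (auto simp: upper_half_def)
    show ?thesis unfolding test_grad_def by (intro continuous_intros 1 2 continuous_radial)
  qed
  define K where "K = {z::(real^'n) \<times> real. \<epsilon> \<le> snd z} \<inter> cball 0 s"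
  have K: "closed K" "bounded K" "K \<subseteq> ?U"
    using \<epsilon> by (auto simp: K_def upper_half_def intro!: closed_Int closed_Collect_le continuous_intros
      intro: bounded_subset[OF bounded_cball])
  have "{z\<in>?U. ?\<eta> z \<noteq> 0} \<subseteq> K"
  proof
    fix z assume z: "z \<in> {z\<in>?U. ?\<eta> z \<noteq> 0}"
    then have "0 < snd z" "trunc \<epsilon> (snd z) \<noteq> 0" "f (z \<bullet> z) \<noteq> 0" by (auto simp: upper_half_def test_def)
    then have "\<epsilon> \<le> snd z" "\<not> s\<^sup>2 \<le> z \<bullet> z" using trunc_bounds(5)[OF \<epsilon>] f_0(1) by force+
    then show "z \<in> K"
      using power_mono[of s "norm z" 2] s by (force simp: K_def dot_square_norm)
  qed
  then have "closure {z\<in>?U. ?\<eta> z \<noteq> 0} \<subseteq> K" using K(1) by (rule closure_minimal)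
  moreover from this have "compact (closure {z\<in>?U. ?\<eta> z \<noteq> 0})"
    using K(2) bounded_subset by (auto simp: compact_eq_bounded_closed)
  ultimately show ?thesis using K(3) der cg unfolding C1c_def by blast
qed
end

section \<open>Testing the weak inequality with radial profiles\<close>

context radial_profile begin

text \<open>The bound is the same for all \<open>\<epsilon>\<close>, as dominated convergence
  requires.\<close>

lemma test_grad_bound:
  fixes z :: "(real^'n) \<times> real"
  assumes "\<And>t. 0 \<le> t \<Longrightarrow> t \<le> r\<^sup>2 \<Longrightarrow> \<bar>f t\<bar> \<le> B" "\<And>t. 0 \<le> t \<Longrightarrow> t \<le> r\<^sup>2 \<Longrightarrow> \<bar>f' t\<bar> \<le> B"
    and \<epsilon>: "0 < \<epsilon>" and z: "z \<in> half_ball r"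
  shows "norm (test_grad \<epsilon> z) \<le> B + 2 * r * B * r"
proof -
  have y: "0 < snd z" "norm z \<le> r" "snd z \<le> r"
    using z norm_snd_le[of "snd z" "fst z"] by (auto simp: half_ball_def)
  have t: "z \<bullet> z \<le> r\<^sup>2" "0 \<le> z \<bullet> z" using power_mono[OF y(2), of 2] by (auto simp: dot_square_norm)
  note b = trunc_bounds[OF \<epsilon> y(1)] assms(1)[OF t(2,1)] assms(2)[OF t(2,1)]
  have "norm (test_grad \<epsilon> z) \<le> \<bar>trunc_deriv \<epsilon> (snd z) * f (z \<bullet> z)\<bar> * 1
      + \<bar>2 * trunc \<epsilon> (snd z) * f' (z \<bullet> z)\<bar> * norm z"
    unfolding test_grad_def by (rule norm_triangle_le) (simp add: norm_Pair)
  also have "\<dots> \<le> (1 * B) * 1 + (2 * r * B) * r"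
    unfolding abs_mult using b y by (intro add_mono mult_mono) auto
  finally show ?thesis by simp
qed

text \<open>\<open>field (0, 1)\<close> is the gradient of \<open>snd z * f (z \<bullet> z)\<close>,
  whose support may reach the boundary. The truncated functions are admissible, and their gradients
  converge pointwise to this field; a constant multiple of the norm of the weak gradient is the
  majorant.\<close>

lemma subharmonic_field_integral:
  fixes u :: "(real^'n) \<times> real \<Rightarrow> real"
  assumes u: "u \<in> H10_tilde" and r: "s < r"
    and sub: "\<And>\<eta> g. C1c upper_half \<eta> g \<Longrightarrow> (\<forall>z\<in>upper_half. 0 \<le> \<eta> z) \<Longrightarrow>
           (LINT z:upper_half|lebesgue. g z \<bullet> weak_grad upper_half u z) \<le> 0"
  shows "(LINT z|lebesgue_on (half_ball r). weak_grad upper_half u z \<bullet> field (0, 1) z) \<le> 0"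
proof -
  define M where "M = lebesgue_on (half_ball r :: ((real^'n) \<times> real) set)"
  define G where "G = weak_grad upper_half u"
  interpret finite_measure M unfolding M_def by (rule finite_measure_half_ball)
  have sp: "space M = half_ball r" by (simp add: M_def)
  note [measurable] = H10_tilde_measurable[OF u, of r, folded M_def, folded G_def]
  have r0: "0 < r" using r s by simp
  have sq: "integrable M (\<lambda>z. (norm (G z))\<^sup>2 + (u z)\<^sup>2)"
    using u r0 by (auto simp: H10_tilde_def set_integral_half_ball G_def M_def)
  have iG: "integrable M G"
    by (rule integrable_if_square_integrable[OF finite_measure_axioms _ sq]) simp_all
  have "bounded (f ` {0..r\<^sup>2})" "bounded (f' ` {0..r\<^sup>2})"
    by (intro compact_imp_bounded compact_continuous_image continuous_on_subset[OF continuous_f]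
        continuous_on_subset[OF continuous_f']; auto)+
  then obtain B1 B2 where "\<forall>t\<in>{0..r\<^sup>2}. \<bar>f t\<bar> \<le> B1" "\<forall>t\<in>{0..r\<^sup>2}. \<bar>f' t\<bar> \<le> B2"
    unfolding bounded_iff by auto
  then have B: "\<And>t. 0 \<le> t \<Longrightarrow> t \<le> r\<^sup>2 \<Longrightarrow> \<bar>f t\<bar> \<le> max B1 B2"
     "\<And>t. 0 \<le> t \<Longrightarrow> t \<le> r\<^sup>2 \<Longrightarrow> \<bar>f' t\<bar> \<le> max B1 B2"
    by (meson atLeastAtMost_iff max.coboundedI1 max.coboundedI2)+
  define B' where "B' = max B1 B2 + 2 * r * max B1 B2 * r"
  define \<epsilon> where "\<epsilon> n = inverse (real (Suc n))" for n
  have \<epsilon>: "0 < \<epsilon> n" for n by (simp add: \<epsilon>_def)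
  have \<epsilon>0: "\<epsilon> \<longlonglongrightarrow> 0" unfolding \<epsilon>_def by (rule LIMSEQ_inverse_real_of_nat)
  have cont: "continuous_on upper_half (test_grad (\<epsilon> n) :: (real^'n) \<times> real \<Rightarrow> _)" for n
    using C1c_test[OF \<epsilon>] by (auto simp: C1c_def)
  have meas: "test_grad (\<epsilon> n) \<in> borel_measurable M" for n
    unfolding M_def
    by (intro measurable_continuous_half_ball continuous_on_subset[OF cont] half_ball_subset_upper_half)
  have neg: "(LINT z|M. test_grad (\<epsilon> n) z \<bullet> G z) \<le> 0" for n
  proof -
    have nn: "\<forall>z\<in>upper_half. 0 \<le> test (\<epsilon> n) (z :: (real^'n) \<times> real)"
      using trunc_bounds(1)[OF \<epsilon>] f_nonneg by (auto simp: test_def upper_half_def)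
    \<comment> \<open>The test gradient vanishes where \<open>s \<le> norm z\<close>, so the
      integral over the half-space is one over the half ball.\<close>
    have "indicator upper_half z *\<^sub>R (test_grad (\<epsilon> n) z \<bullet> G z)
        = indicator (half_ball r) z *\<^sub>R (test_grad (\<epsilon> n) z \<bullet> G z)" for z
      using test_grad_eq_0[of z "\<epsilon> n"] r
      by (cases "norm z < r") (auto simp: indicator_def half_ball_def upper_half_def)
    then have "(LINT z|M. test_grad (\<epsilon> n) z \<bullet> G z)
       = (LINT z:upper_half|lebesgue. test_grad (\<epsilon> n) z \<bullet> G z)"
      unfolding M_def set_integral_half_ball(1)[symmetric] set_lebesgue_integral_def by (simp only:)
    then show ?thesis using sub[OF C1c_test[OF \<epsilon>] nn] by (simp add: G_def)
  qed
  have "(\<lambda>n. LINT z|M. test_grad (\<epsilon> n) z \<bullet> G z) \<longlonglongrightarrow> (LINT z|M. G z \<bullet> field (0, 1) z)"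
  proof (rule integral_dominated_convergence)
    show "integrable M (\<lambda>z. B' * norm (G z))" using iG by simp
    show "AE z in M. norm (test_grad (\<epsilon> n) z \<bullet> G z) \<le> B' * norm (G z)" for n
    proof (rule AE_I2)
      fix z assume "z \<in> space M"
      then have "norm (test_grad (\<epsilon> n) z) \<le> B'"
        using test_grad_bound[OF B \<epsilon>] by (simp add: sp B'_def)
      then have "norm (test_grad (\<epsilon> n) z) * norm (G z) \<le> B' * norm (G z)"
        by (rule mult_right_mono) simp
      then show "norm (test_grad (\<epsilon> n) z \<bullet> G z) \<le> B' * norm (G z)"
        using Cauchy_Schwarz_ineq2[of "test_grad (\<epsilon> n) z" "G z"] by simp
    qed
    show "AE z in M. (\<lambda>n. test_grad (\<epsilon> n) z \<bullet> G z) \<longlonglongrightarrow> G z \<bullet> field (0, 1) z"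
    proof (rule AE_I2)
      fix z assume "z \<in> space M"
      then have y: "0 < snd z" by (simp add: sp half_ball_def)
      have "(\<lambda>n. test_grad (\<epsilon> n) z \<bullet> G z) \<longlonglongrightarrow>
        ((1 * f (z \<bullet> z)) *\<^sub>R (0, 1) + (2 * snd z * f' (z \<bullet> z)) *\<^sub>R z) \<bullet> G z"
        unfolding test_grad_def by (intro tendsto_intros trunc_tendsto[OF y \<epsilon>0])
      then show "(\<lambda>n. test_grad (\<epsilon> n) z \<bullet> G z) \<longlonglongrightarrow> G z \<bullet> field (0, 1) z"
        by (simp add: field_def inner_prod_def[of z "(0,1)"] inner_commute)
    qed
    show "(\<lambda>z. test_grad (\<epsilon> n) z \<bullet> G z) \<in> borel_measurable M" for n
      using meas[of n] by measurable
    have [measurable]: "field (0, 1) \<in> borel_measurable M"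
      unfolding M_def by (rule measurable_continuous_half_ball[OF continuous_field])
    show "(\<lambda>z. G z \<bullet> field (0, 1) z) \<in> borel_measurable M" by measurable
  qed
  then show ?thesis
    using LIMSEQ_le_const2[of _ _ 0] neg unfolding M_def G_def by blast
qed

text \<open>\<open>D\<close> is the Laplacian of the test function
  \<open>snd z * f (z \<bullet> z)\<close>: the weak inequality controls the integral of the
  gradients, and the zero trace of \<open>u\<close> moves the second derivative onto the test
  function. The ambient dimension is \<open>CARD('n) + 1\<close>, whence
  \<open>CARD('n) + 3\<close>.\<close>

lemma subharmonic_radial_test:
  fixes u :: "(real^'n) \<times> real \<Rightarrow> real"
  assumes u: "u \<in> H10_tilde" and r: "s < r"
    and sub: "\<And>\<eta> g. C1c upper_half \<eta> g \<Longrightarrow> (\<forall>z\<in>upper_half. 0 \<le> \<eta> z) \<Longrightarrow>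
           (LINT z:upper_half|lebesgue. g z \<bullet> weak_grad upper_half u z) \<le> 0"
  defines "D \<equiv> \<lambda>z::(real^'n) \<times> real. snd z * (4 * (z \<bullet> z) * f'' (z \<bullet> z) + 2 * (real CARD('n) + 3) * f' (z \<bullet> z))"
  shows "integrable (lebesgue_on (half_ball r)) (\<lambda>z. u z * D z)"
    and "0 \<le> (LINT z|lebesgue_on (half_ball r). u z * D z)"
proof -
  have e: "(0, 1) \<in> (Basis :: ((real^'n) \<times> real) set)" by (simp add: Basis_prod_def)
  have D: "(\<Sum>b\<in>Basis. field_deriv (0, 1) b z \<bullet> b) = D z" for z
    unfolding divergence_field[OF e] D_def by (simp add: inner_prod_def[of z "(0,1)"] add.commute)
  note * = H10_tilde_divergence[OF u _ field_has_derivative continuous_field_deriv r field_eq_0, of "(0,1)", unfolded D]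
  show "integrable (lebesgue_on (half_ball r)) (\<lambda>z. u z * D z)"
    using *(2) r s by simp
  show "0 \<le> (LINT z|lebesgue_on (half_ball r). u z * D z)"
    using *(3) subharmonic_field_integral[OF u r sub] r s by simp
qed
end

section \<open>The radial profile\<close>

text \<open>With \<open>\<sigma>\<close> rising from 0 at \<open>T\<close> to 1 at
  \<open>2 * T\<close>, the function is \<open>(1 - \<sigma>\<^sup>2)\<^sup>2\<close> in between.
  One continuous derivative suffices because the cutoff multiplies \<open>f'\<close>, not
  \<open>f\<close>. The constant 4 is the product of two factors 2 from differentiating
  squares.\<close>

lemma ex_cutoff:
  fixes T :: real
  assumes T: "0 < T"
  shows "\<exists>\<kappa> \<kappa>'. (\<forall>t. (\<kappa> has_real_derivative \<kappa>' t) (at t)) \<and> continuous_on UNIV \<kappa>' \<and>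
    (\<forall>t. 0 \<le> \<kappa> t) \<and> (\<forall>t\<le>T. \<kappa> t = 1 \<and> \<kappa>' t = 0) \<and> (\<forall>t\<ge>2*T. \<kappa> t = 0 \<and> \<kappa>' t = 0) \<and>
    (\<forall>t. - (4 / T) \<le> \<kappa>' t)"
proof -
  define \<sigma> where "\<sigma> t = (t - T) / T" for t
  define \<kappa> where "\<kappa> t = (max 0 (1 - (max 0 (\<sigma> t))\<^sup>2))\<^sup>2" for t
  define \<kappa>' where "\<kappa>' t = 2 * max 0 (1 - (max 0 (\<sigma> t))\<^sup>2) * (0 - 2 * max 0 (\<sigma> t) * (1 / T))" for t
  have "(\<kappa> has_real_derivative \<kappa>' t) (at t)" for t
  proof -
    have "(\<sigma> has_real_derivative 1 / T) (at t)"
      unfolding \<sigma>_def using T by (auto intro!: derivative_eq_intros)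
    from DERIV_chain2[OF has_real_derivative_pos_part_square this]
    have "((\<lambda>t. 1 - (max 0 (\<sigma> t))\<^sup>2) has_real_derivative 0 - 2 * max 0 (\<sigma> t) * (1 / T)) (at t)"
      by (rule DERIV_diff[OF DERIV_const])
    from DERIV_chain2[OF has_real_derivative_pos_part_square this]
    show ?thesis unfolding \<kappa>_def \<kappa>'_def .
  qed
  moreover have "continuous_on UNIV \<kappa>'"
    unfolding \<kappa>'_def \<sigma>_def using T by (intro continuous_intros) auto
  moreover have "0 \<le> \<kappa> t" for t by (simp add: \<kappa>_def)
  moreover have "\<kappa> t = 1 \<and> \<kappa>' t = 0" if "t \<le> T" for t
  proof -
    have "\<sigma> t \<le> 0" using that T by (simp add: \<sigma>_def divide_le_0_iff)
    then show ?thesis by (simp add: \<kappa>_def \<kappa>'_def)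
  qed
  moreover have "\<kappa> t = 0 \<and> \<kappa>' t = 0" if "2 * T \<le> t" for t
  proof -
    have "1 \<le> max 0 (\<sigma> t)" using that T by (simp add: \<sigma>_def field_simps max_def)
    then have "1 \<le> (max 0 (\<sigma> t))\<^sup>2" by (rule one_le_power)
    then show ?thesis by (simp add: \<kappa>_def \<kappa>'_def)
  qed
  moreover have "- (4 / T) \<le> \<kappa>' t" for t
  proof (cases "max 0 (\<sigma> t) \<le> 1")
    case True
    have "max 0 (1 - (max 0 (\<sigma> t))\<^sup>2) * max 0 (\<sigma> t) \<le> 1 * 1"
      by (intro mult_mono True) auto
    then have "4 / T * (max 0 (1 - (max 0 (\<sigma> t))\<^sup>2) * max 0 (\<sigma> t)) \<le> 4 / T * 1"
      using T by (intro mult_left_mono) auto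
    then show ?thesis by (simp add: \<kappa>'_def algebra_simps)
  next
    case False
    then have "1 \<le> (max 0 (\<sigma> t))\<^sup>2" by (intro one_le_power) simp
    then show ?thesis using T by (simp add: \<kappa>'_def)
  qed
  ultimately show ?thesis by blast
qed

text \<open>Without the cutoff, \<open>f' = -(1 + t)\<^sup>-\<^sup>p\<close> gives \<open>4 t f'' + 4 p f' = -4 p (1 + t)\<^sup>-\<^sup>p\<^sup>-\<^sup>1\<close>; with
  \<open>4 p = 2 (N + 2)\<close> the left-hand side is \<open>\<Delta> (y f (z \<bullet> z)) / y\<close> in dimension \<open>N\<close>.\<close>

lemma ex_radial_profile:
  fixes p T :: real
  assumes p: "0 < p" and T: "0 < T"
  shows "\<exists>f f' f''. radial_profile f f' f'' (sqrt (2 * T)) \<and>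
    (\<forall>t\<ge>0. 4 * t * f'' t + 4 * p * f' t
       \<le> 32 * T powr (- p) - 4 * p * (1 + t) powr (- p - 1) * indicator {..T} t)"
proof -
  obtain \<kappa> \<kappa>' where \<kappa>: "\<And>t. (\<kappa> has_real_derivative \<kappa>' t) (at t)" "continuous_on UNIV \<kappa>'"
    "\<And>t. 0 \<le> \<kappa> t" "\<And>t. t \<le> T \<Longrightarrow> \<kappa> t = 1 \<and> \<kappa>' t = 0" "\<And>t. 2*T \<le> t \<Longrightarrow> \<kappa> t = 0 \<and> \<kappa>' t = 0"
    "\<And>t. - (4 / T) \<le> \<kappa>' t"
    using ex_cutoff[OF T] by auto
  \<comment> \<open>\<open>h\<close> is the cut-off \<open>- f'\<close>, and \<open>h'\<close> is
    its derivative.\<close>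
  define h where "h t = (1 + t) powr (- p) * \<kappa> t" for t
  define h' where "h' t = (1 + t) powr (- p) * \<kappa>' t - p * (1 + t) powr (- p - 1) * \<kappa> t" for t
  \<comment> \<open>On \<open>0 \<le> t \<le> 2 * T\<close> this is the integral of \<open>h\<close>
    from \<open>t\<close> to \<open>2 * T\<close>. The base point \<open>-1/2\<close> lies left of
    0, so \<open>f\<close> is differentiable from both sides at 0, and right of \<open>-1\<close>,
    where the power is singular.\<close>
  define f where "f t = integral {-1/2..2*T} h - integral {-1/2..t} h" for t
  have c\<kappa>: "continuous_on S \<kappa>" for S
    by (intro continuous_at_imp_continuous_on ballI DERIV_isCont[OF \<kappa>(1)])
  have ch: "continuous_on {-1/2..} h"
    unfolding h_def by (intro continuous_intros c\<kappa>) auto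
  have ih: "h integrable_on {a..b}" if "-1/2 \<le> a" for a b
    by (intro integrable_continuous_real continuous_on_subset[OF ch]) (use that in auto)
  have f_left: "f t = integral {t..2*T} h" if "0 \<le> t" "t \<le> 2 * T" for t
    using Henstock_Kurzweil_Integration.integral_combine[of "-1/2" t "2*T" h] ih that by (simp add: f_def)
  have f_right: "f t = 0" if "2 * T \<le> t" for t
  proof -
    have "integral {2*T..t} h = integral {2*T..t} (\<lambda>_. 0)"
      by (intro Henstock_Kurzweil_Integration.integral_cong) (simp add: h_def \<kappa>(5))
    then show ?thesis
      using Henstock_Kurzweil_Integration.integral_combine[of "-1/2" "2*T" t h] ih that T
      by (simp add: f_def)
  qed
  have "radial_profile f (\<lambda>t. - h t) (\<lambda>t. - h' t) (sqrt (2 * T))"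
  proof
    fix t :: real assume t: "0 \<le> t"
    have "((\<lambda>x. integral {-1/2..x} h) has_real_derivative h t) (at t within {-1/2..t+1})"
      by (intro integral_has_real_derivative continuous_on_subset[OF ch]) (use t in auto)
    then have "((\<lambda>x. integral {-1/2..x} h) has_real_derivative h t) (at t)"
      using at_within_Icc_at[of "-1/2" t "t + 1"] t by simp
    then show "(f has_real_derivative - h t) (at t)"
      unfolding f_def by (auto intro!: derivative_eq_intros)
    have "((\<lambda>t. (1 + t) powr (- p)) has_real_derivative - p * (1 + t) powr (- p - 1)) (at t)"
      using t by (auto intro!: derivative_eq_intros simp: field_simps powr_diff)
    from DERIV_minus[OF DERIV_mult[OF this \<kappa>(1)]]
    show "((\<lambda>t. - h t) has_real_derivative - h' t) (at t)"
      unfolding h_def h'_def by (simp add: algebra_simps)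
    show "0 \<le> f t"
    proof (cases "t \<le> 2 * T")
      case True
      have "0 \<le> integral {t..2*T} h"
        by (rule integral_nonneg[OF ih]) (use t \<kappa>(3) in \<open>auto simp: h_def\<close>)
      then show ?thesis using f_left[OF t True] by simp
    qed (use f_right[of t] in auto)
  next
    show "continuous_on {0..} (\<lambda>t. - h' t)"
      unfolding h'_def by (intro continuous_intros c\<kappa> continuous_on_subset[OF \<kappa>(2)]) auto
  qed (use T f_right \<kappa>(5) in \<open>auto simp: h_def\<close>)
  moreover have "4 * t * (- h' t) + 4 * p * (- h t)
       \<le> 32 * T powr (- p) - 4 * p * (1 + t) powr (- p - 1) * indicator {..T} t" if t: "0 \<le> t" for t
  proof -
    have pw: "(1 + t) powr (- p) = (1 + t) * (1 + t) powr (- p - 1)"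
      using t by (simp add: powr_diff)
    \<comment> \<open>Writing \<open>(1 + t) powr (- p)\<close> as \<open>(1 + t)\<close> times the
      next lower power cancels the terms with factor \<open>t\<close> that contain
      \<open>\<kappa>\<close>.\<close>
    have "4 * t * (- h' t) + 4 * p * (- h t)
       = - 4 * t * (1 + t) powr (- p) * \<kappa>' t - 4 * p * (1 + t) powr (- p - 1) * \<kappa> t"
      unfolding h_def h'_def pw by (simp add: algebra_simps)
    also have "\<dots> \<le> 32 * T powr (- p) - 4 * p * (1 + t) powr (- p - 1) * indicator {..T} t"
    proof (intro diff_mono)
      show "4 * p * (1 + t) powr (- p - 1) * indicator {..T} t \<le> 4 * p * (1 + t) powr (- p - 1) * \<kappa> t"
        using p \<kappa>(3,4)[of t] by (intro mult_left_mono) (auto simp: indicator_def)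
      \<comment> \<open>\<open>\<kappa>'\<close> can be nonzero only for
        \<open>T < t < 2 * T\<close>; there \<open>t\<close> is at most \<open>2 * T\<close> and
        \<open>- \<kappa>' t\<close> at most \<open>4 / T\<close>, so the constant is
        \<open>4 * 2 * 4\<close>.\<close>
      show "- 4 * t * (1 + t) powr (- p) * \<kappa>' t \<le> 32 * T powr (- p)"
      proof (cases "T < t \<and> t < 2 * T")
        case True
        have pw_le: "(1 + t) powr (- p) \<le> T powr (- p)" using True T p by (intro powr_mono2') auto
        have "- 4 * t * (1 + t) powr (- p) * \<kappa>' t = 4 * t * (1 + t) powr (- p) * (- \<kappa>' t)" by simp
        also have "\<dots> \<le> 4 * t * (1 + t) powr (- p) * (4 / T)"
          using t \<kappa>(6)[of t] by (intro mult_left_mono) auto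
        also have "\<dots> \<le> 4 * (2 * T) * T powr (- p) * (4 / T)"
          using True T by (intro mult_right_mono mult_mono pw_le) auto
        also have "\<dots> = 32 * T powr (- p)" using T by simp
        finally show ?thesis .
      next
        case False
        then have "\<kappa>' t = 0" using \<kappa>(4,5)[of t] by linarith
        then show ?thesis by simp
      qed
    qed
    finally show ?thesis .
  qed
  ultimately show ?thesis by blast
qed

section \<open>The Liouville theorem\<close>

text \<open>The profile with \<open>T = R\<^sup>2\<close> is tested. Its Laplacian is at most minus
  \<open>4 * p\<close> times the weight in \<open>F\<close> on the half ball of radius
  \<open>\<rho> \<le> R\<close>, plus an error of order \<open>snd z * R powr (- 2 * p)\<close>.
  Weight and \<open>\<rho>\<close> do not depend on \<open>R\<close>, so \<open>R\<close> remains
  free to tend to infinity.\<close>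

lemma subharmonic_weighted_bound:
  fixes w :: "(real ^ 'n) \<times> real \<Rightarrow> real" and C d :: real
  assumes w: "w \<in> H10_tilde"
    and sub: "\<And>\<eta> g. C1c upper_half \<eta> g \<Longrightarrow> (\<forall>z\<in>upper_half. 0 \<le> \<eta> z) \<Longrightarrow>
           (LINT z:upper_half|lebesgue. g z \<bullet> weak_grad upper_half w z) \<le> 0"
    and C: "0 < C" and d: "0 \<le> d" "d < 1"
    and bd: "AE z\<in>upper_half in lebesgue. 0 \<le> w z \<and> w z \<le> C * (snd z powr d + 1)"
    and \<rho>: "0 < \<rho>"
  defines "p \<equiv> (real CARD('n) + 3) / 2"
  defines "F \<equiv> \<lambda>z. w z * (snd z * (1 + z \<bullet> z) powr (- p - 1))"
  shows "integrable (lebesgue_on (half_ball \<rho>)) F"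
    and "\<exists>K. \<forall>R\<ge>max 1 \<rho>. (LINT z|lebesgue_on (half_ball \<rho>). F z) \<le> K * R powr (d - 1)"
proof -
  define N where "N = DIM((real^'n) \<times> real)"
  have N: "real N = real CARD('n) + 1" by (simp add: N_def)
  have p: "4 * p = 2 * (real CARD('n) + 3)" "0 < p" "2 * p = real N + 2" by (auto simp: p_def N)
  have bdr: "AE z in lebesgue_on (half_ball r). 0 \<le> w z \<and> w z \<le> C * (snd z powr d + 1)" for r
    using bd open_half_ball[of r, where 'n='n] half_ball_subset_upper_half[of r]
    by (subst AE_restrict_space_iff) (auto elim!: eventually_mono)
  have iF: "integrable (lebesgue_on (half_ball r)) F" if r: "0 < r" for r
  proof -
    interpret finite_measure "lebesgue_on (half_ball r :: ((real^'n) \<times> real) set)"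
      by (rule finite_measure_half_ball)
    have "integrable (lebesgue_on (half_ball r)) w"
    proof (rule integrable_if_square_integrable[OF finite_measure_axioms])
      show "integrable (lebesgue_on (half_ball r)) (\<lambda>z. (norm (weak_grad upper_half w z))\<^sup>2 + (w z)\<^sup>2)"
        using w r by (auto simp: H10_tilde_def set_integral_half_ball)
    qed (use H10_tilde_measurable[OF w] in auto)
    moreover have "(\<lambda>z::(real^'n) \<times> real. snd z * (1 + z \<bullet> z) powr (- p - 1))
        \<in> borel_measurable (lebesgue_on (half_ball r))"
    proof (intro measurable_continuous_half_ball continuous_intros ballI)
      show "1 + z \<bullet> z \<noteq> 0" for z :: "(real^'n) \<times> real"
        using inner_ge_zero[of z] by linarith
    qed
    moreover have "norm (snd z * (1 + z \<bullet> z) powr (- p - 1)) \<le> r * 1"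
      if "z \<in> half_ball r" for z :: "(real^'n) \<times> real"
    proof -
      have "\<bar>snd z\<bar> \<le> r"
        using that norm_snd_le[of "snd z" "fst z"] by (auto simp: half_ball_def)
      moreover have "(1 + z \<bullet> z) powr (- p - 1) \<le> 1"
        using powr_mono[of "- p - 1" 0 "1 + z \<bullet> z"] p add_pos_nonneg[OF zero_less_one inner_ge_zero[of z]]
        by simp
      ultimately show ?thesis
        unfolding norm_mult using r by (intro mult_mono) auto
    qed
    ultimately show ?thesis
      unfolding F_def using integrable_bounded_mult[of "lebesgue_on (half_ball r)" w _ "r * 1"] by simp
  qed
  show "integrable (lebesgue_on (half_ball \<rho>)) F" by (rule iF[OF \<rho>])
  define V where "V = unit_ball_vol (real N)"
  \<comment> \<open>\<open>192 = 6 * 32\<close>: the 6 comes from the bound on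
    \<open>w z * snd z\<close>, the 32 from the cutoff error. \<open>V * 2 ^ N\<close> comes from
    the volume of the ball of radius \<open>2 * R\<close>.\<close>
  define K where "K = 192 * C * V * 2 ^ N / (4 * p)"
  have "(LINT z|lebesgue_on (half_ball \<rho>). F z) \<le> K * R powr (d - 1)" if R: "max 1 \<rho> \<le> R" for R
  proof -
    have R1: "1 \<le> R" "\<rho> \<le> R" "0 < R" using R by auto
    define M where "M = lebesgue_on (half_ball (2 * R) :: ((real^'n) \<times> real) set)"
    interpret finite_measure M unfolding M_def by (rule finite_measure_half_ball)
    have "0 < R\<^sup>2" using R1 by simp
    then obtain f f' f'' where prof: "radial_profile f f' f'' (sqrt (2 * R\<^sup>2))"
      and le: "\<And>t. 0 \<le> t \<Longrightarrow> 4 * t * f'' t + 4 * p * f' t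
       \<le> 32 * (R\<^sup>2) powr (- p) - 4 * p * (1 + t) powr (- p - 1) * indicator {..R\<^sup>2} t"
      using ex_radial_profile[OF p(2)] by metis
    interpret radial_profile f f' f'' "sqrt (2 * R\<^sup>2)" by (rule prof)
    define D where "D z = snd z * (4 * (z \<bullet> z) * f'' (z \<bullet> z) + 2 * (real CARD('n) + 3) * f' (z \<bullet> z))"
      for z :: "(real^'n) \<times> real"
    have s: "sqrt (2 * R\<^sup>2) < 2 * R"
      using R1 by (intro real_less_lsqrt) (auto simp: power2_eq_square)
    have iD: "integrable M (\<lambda>z. w z * D z)" "0 \<le> (LINT z|M. w z * D z)"
      using subharmonic_radial_test[OF w s sub] unfolding M_def D_def by simp_all
    \<comment> \<open>On the half ball of radius \<open>2 * R\<close>, \<open>w\<close> is at most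
      \<open>3 * C * R powr d\<close> and \<open>snd z\<close> at most \<open>2 * R\<close>; the
      last factor is the cutoff error.\<close>
    define A where "A = 6 * C * R powr (1 + d) * (32 * (R\<^sup>2) powr (- p))"
    have A0: "0 \<le> A" using C by (simp add: A_def)
    have pointwise: "w z * D z \<le> A - 4 * p * (indicator (half_ball \<rho>) z *\<^sub>R F z)"
      if z: "z \<in> half_ball (2 * R)" and wz: "0 \<le> w z" "w z \<le> C * (snd z powr d + 1)" for z
    proof -
      define k where "k = (1 + z \<bullet> z) powr (- p - 1)"
      have y: "0 < snd z" "snd z \<le> 2 * R"
        using z norm_snd_le[of "snd z" "fst z"] by (auto simp: half_ball_def)
      have "w z \<le> C * (2 * R powr d + R powr d)"
      proof -
        have "snd z powr d \<le> (2 * R) powr d" using y d by (intro powr_mono2) auto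
        also have "\<dots> = 2 powr d * R powr d" using R1 by (simp add: powr_mult)
        also have "\<dots> \<le> 2 powr 1 * R powr d"
          using d by (intro mult_right_mono powr_mono) auto
        finally have "snd z powr d \<le> 2 * R powr d" by simp
        moreover have "1 \<le> R powr d" using R1 d by (simp add: ge_one_powr_ge_zero)
        ultimately have "C * (snd z powr d + 1) \<le> C * (2 * R powr d + R powr d)"
          using C by (intro mult_left_mono) auto
        then show ?thesis using wz(2) by simp
      qed
      then have "w z * snd z \<le> (C * (2 * R powr d + R powr d)) * (2 * R)"
        using y wz R1 C by (intro mult_mono) auto
      also have "\<dots> = 6 * C * R powr (1 + d)" using R1 by (simp add: powr_add)
      finally have wy: "w z * snd z \<le> 6 * C * R powr (1 + d)" .
      \<comment> \<open>Shrinking the region where the negative term is kept, from radius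
        \<open>R\<close> to the fixed \<open>\<rho>\<close>, only weakens the estimate because
        \<open>w\<close> and the weight are non-negative.\<close>
      have ind: "indicator (half_ball \<rho>) z \<le> (indicator {..R\<^sup>2} (z \<bullet> z) :: real)"
      proof (cases "z \<in> half_ball \<rho>")
        case True
        then have "(norm z)\<^sup>2 \<le> R\<^sup>2" using R1 by (intro power_mono) (auto simp: half_ball_def)
        then show ?thesis by (simp add: dot_square_norm)
      qed simp
      have "w z * D z = (w z * snd z) * (4 * (z \<bullet> z) * f'' (z \<bullet> z) + 4 * p * f' (z \<bullet> z))"
        unfolding p(1) by (simp add: D_def)
      also have "\<dots> \<le> (w z * snd z) * (32 * (R\<^sup>2) powr (- p) - 4 * p * k * indicator {..R\<^sup>2} (z \<bullet> z))"
        unfolding k_def using wz y by (intro mult_left_mono le) auto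
      also have "\<dots> = (w z * snd z) * (32 * (R\<^sup>2) powr (- p))
           - 4 * p * (indicator {..R\<^sup>2} (z \<bullet> z) * (w z * (snd z * k)))"
        by (simp add: algebra_simps)
      also have "\<dots> \<le> A - 4 * p * (indicator (half_ball \<rho>) z * (w z * (snd z * k)))"
        unfolding A_def using p wz y ind
        by (intro diff_mono mult_right_mono mult_left_mono wy) (auto simp: k_def)
      finally show ?thesis by (simp add: F_def k_def)
    qed
    have sub\<rho>: "half_ball \<rho> \<subseteq> (half_ball (2 * R) :: ((real^'n) \<times> real) set)"
      using R1 by (auto simp: half_ball_def)
    have iI: "integrable M (\<lambda>z. indicator (half_ball \<rho>) z *\<^sub>R F z)"
    proof (rule integrable_mult_indicator)
      show "half_ball \<rho> \<in> sets M"
        unfolding M_def using sub\<rho> open_half_ball[of \<rho>, where 'n='n]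
        by (auto simp: sets_restrict_space_iff open_half_ball)
    qed (use iF[of "2*R"] R1 in \<open>simp add: M_def\<close>)
    have "0 \<le> (LINT z|M. w z * D z)" by (rule iD(2))
    also have "\<dots> \<le> (LINT z|M. A - 4 * p * (indicator (half_ball \<rho>) z *\<^sub>R F z))"
    proof (rule integral_mono_AE)
      show "AE z in M. w z * D z \<le> A - 4 * p * (indicator (half_ball \<rho>) z *\<^sub>R F z)"
        using bdr[of "2*R"] AE_space unfolding M_def[symmetric]
        by eventually_elim (use pointwise in \<open>auto simp: M_def\<close>)
    qed (intro iD(1) Bochner_Integration.integrable_diff integrable_const integrable_mult_right iI)+
    also have "\<dots> = measure M (space M) * A - 4 * p * (LINT z|M. indicator (half_ball \<rho>) z *\<^sub>R F z)"
      using iI by simp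
    also have "(LINT z|M. indicator (half_ball \<rho>) z *\<^sub>R F z) = (LINT z|lebesgue_on (half_ball \<rho>). F z)"
    proof -
      have "indicator (half_ball (2*R)) z *\<^sub>R (indicator (half_ball \<rho>) z *\<^sub>R F z) = indicator (half_ball \<rho>) z *\<^sub>R F z" for z
        using sub\<rho> by (auto simp: indicator_def)
      then show ?thesis
        unfolding M_def set_integral_half_ball(1)[symmetric] set_lebesgue_integral_def by (simp only:)
    qed
    finally have "4 * p * (LINT z|lebesgue_on (half_ball \<rho>). F z) \<le> measure M (space M) * A" by simp
    also have "\<dots> \<le> (V * (2 * R) ^ N) * A"
    proof (rule mult_right_mono[OF _ A0])
      have "measure M (space M) = measure lebesgue (half_ball (2 * R) :: ((real^'n) \<times> real) set)"
        unfolding M_def by (simp add: measure_restrict_space fmeasurableD[OF lmeasurable_half_ball])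
      also have "\<dots> \<le> measure lebesgue (ball 0 (2 * R) :: ((real^'n) \<times> real) set)"
        by (intro measure_mono_fmeasurable half_ball_subset_ball fmeasurableD lmeasurable_half_ball) simp
      also have "\<dots> = V * (2 * R) ^ N"
        using R1 content_ball[of "2*R" "0::(real^'n) \<times> real"] by (simp add: V_def N_def)
      finally show "measure M (space M) \<le> V * (2 * R) ^ N" .
    qed
    \<comment> \<open>The exponents add up: \<open>(1 + d) - (N + 2) + N = d - 1\<close>, from the
      bound on \<open>w z * snd z\<close>, the cutoff error and the volume.\<close>
    also have "\<dots> = 192 * C * V * 2 ^ N * R powr (d - 1)"
    proof -
      have "(R\<^sup>2) powr (- p) = R powr (- (real N + 2))"
        using R1 unfolding p(3)[symmetric] by (simp add: powr_powr flip: powr_numeral)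
      moreover have "R powr (1 + d) * (R powr (- (real N + 2)) * R ^ N) = R powr (d - 1)"
        using R1 by (simp add: powr_realpow[symmetric] flip: powr_add)
      ultimately show ?thesis by (simp add: A_def power_mult_distrib algebra_simps)
    qed
    finally show ?thesis using p(2) by (simp add: K_def field_simps)
  qed
  then show "\<exists>K. \<forall>R\<ge>max 1 \<rho>. (LINT z|lebesgue_on (half_ball \<rho>). F z) \<le> K * R powr (d - 1)" by blast
qed

theorem theorem3p5:
  fixes w :: "(real ^ 'n) \<times> real \<Rightarrow> real" and C d :: real
  assumes "w \<in> H10_tilde"
    and "\<And>\<eta> g. C1c upper_half \<eta> g \<Longrightarrow> (\<forall>z\<in>upper_half. 0 \<le> \<eta> z) \<Longrightarrow>
           (LINT z:upper_half|lebesgue. g z \<bullet> weak_grad upper_half w z) \<le> 0"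
    and "0 < C" and "0 \<le> d" and "d < 1"
    and "AE z\<in>upper_half in lebesgue. 0 \<le> w z \<and> w z \<le> C * (snd z powr d + 1)"
  shows "AE z\<in>upper_half in lebesgue. w z = 0"
proof -
  \<comment> \<open>Countably many half balls cover the half-space, so their null sets can be
    united. \<open>Suc n\<close> keeps the radius positive, as the weighted bound demands.\<close>
  have *: "AE z in lebesgue. z \<in> half_ball (real (Suc n)) \<longrightarrow> w z = 0" for n
  proof -
    define M where "M = lebesgue_on (half_ball (real (Suc n)) :: ((real^'n) \<times> real) set)"
    define F where "F z = w z * (snd z * (1 + z \<bullet> z) powr (- ((real CARD('n) + 3) / 2) - 1))" for z
    note bound = subharmonic_weighted_bound[where \<rho> = "real (Suc n)", OF assms(1) _ assms(3-6)]
    have iF: "integrable M F"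
      unfolding M_def F_def by (rule bound(1)) (auto intro: assms(2) simp del: of_nat_Suc)
    have "\<exists>K. \<forall>R\<ge>max 1 (real (Suc n)). (LINT z|M. F z) \<le> K * R powr (d - 1)"
      unfolding M_def F_def by (rule bound(2)) (auto intro: assms(2) simp del: of_nat_Suc)
    then obtain K where K: "\<And>R. max 1 (real (Suc n)) \<le> R \<Longrightarrow> (LINT z|M. F z) \<le> K * R powr (d - 1)"
      by blast
    \<comment> \<open>The left-hand side does not depend on \<open>R\<close>, and since
      \<open>d < 1\<close> the bound tends to 0.\<close>
    have "(LINT z|M. F z) \<le> 0"
    proof (rule tendsto_lowerbound)
      have "((\<lambda>R. R powr (d - 1)) \<longlongrightarrow> 0) at_top"
        using assms(5) by (intro tendsto_neg_powr filterlim_ident) simp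
      then show "((\<lambda>R. K * R powr (d - 1)) \<longlongrightarrow> 0) at_top"
        using tendsto_mult_right_zero by blast
      show "eventually (\<lambda>R. (LINT z|M. F z) \<le> K * R powr (d - 1)) at_top"
        using eventually_ge_at_top[of "max 1 (real (Suc n))"] by eventually_elim (rule K)
    qed simp
    moreover have nn: "AE z in M. 0 \<le> F z"
      using assms(6) open_half_ball[of "real (Suc n)", where 'n='n]
      unfolding M_def F_def
      by (subst AE_restrict_space_iff)
        (auto elim!: eventually_mono simp: half_ball_def upper_half_def)
    ultimately have "(LINT z|M. F z) = 0"
      using integral_nonneg_AE[OF nn] by simp
    then have "AE z in M. F z = 0"
      using integral_nonneg_eq_0_iff_AE[OF iF nn] by simp
    then have "AE z in lebesgue. z \<in> half_ball (real (Suc n)) \<longrightarrow> F z = 0"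
      unfolding M_def using open_half_ball[of "real (Suc n)", where 'n='n]
      by (subst (asm) AE_restrict_space_iff) auto
    then show ?thesis
    \<comment> \<open>The weight is strictly positive where \<open>snd z > 0\<close>, so
      \<open>F z = 0\<close> forces \<open>w z = 0\<close>.\<close>
    proof eventually_elim
      case (elim z)
      have "1 + z \<bullet> z \<noteq> 0" using inner_ge_zero[of z] by linarith
      then show ?case using elim by (auto simp: F_def half_ball_def)
    qed
  qed
  have "AE z in lebesgue. \<forall>n. z \<in> half_ball (real (Suc n)) \<longrightarrow> w z = 0"
    unfolding AE_all_countable using * by blast
  then show ?thesis
  proof eventually_elim
    case (elim z)
    obtain n where "norm z < real n" using reals_Archimedean2 by blast
    then have "norm z < real (Suc n)" by simp
    then show ?case using elim by (auto simp: half_ball_def upper_half_def)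
  qed
qed

end
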